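(* Let $X, X_1, X_2, \ldots$ be i.i.d. mean zero random elements of $L^2 = L^2(\mathcal{T})$, where $X$ is regularly varying with index $\alpha \in (2,4)$. Let $C=E[X\otimes X]$, let $v_1,v_2,\ldots$ be the orthonormal eigenfunctions of $C$, $\xi_j=\langle X,v_j\rangle$, and suppose that $Q_{nm}>0$ for all $n,m\ge1$, where $$Q_{nm} = \lim_{u\to\infty} \frac{P\left( \left\{\sum_{j=n}^\infty \xi_j^2\right\}^{1/2} \left\{\sum_{j=m}^\infty \xi_j^2\right\}^{1/2} > u\right)}{P\left(\sum_{j=1}^\infty \xi_j^2 > u\right)}.$$ Let $\widehat C=N^{-1}\sum_{n=1}^N X_n\otimes X_n$. Then, for any $\gamma\in[1,\alpha/2)$, $N^{1-1/\gamma}\|\widehat C-C\|_{\mathcal{S}}\to0$ as $N\to\infty$ with probability 1.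
   Context: $L^2(\mathcal{T})$ is the separable Hilbert space of square integrable real functions on a compact subset $\mathcal{T}$ of a Euclidean space. $\mathcal{S}$ is the Hilbert space of Hilbert–Schmidt operators on $L^2$, with Hilbert–Schmidt norm $\|\cdot\|_{\mathcal{S}}$. For $y,z\in L^2$, $(y\otimes z)(x)=\langle y,x\rangle z$. The eigenfunctions $v_j$ are ordered by decreasing eigenvalues, so that $X=\sum_j\xi_jv_j$. Regular variation: a random element $X$ of a separable Banach space is regularly varying with index $\alpha>0$ if $P(\|X\|>u)=u^{-\alpha}L(u)$ for some slowly varying $L$ and, for a probability measure $\Gamma_X$ on the unit sphere, $P(X/\|X\|\in\cdot\mid\|X\|>u)\to\Gamma_X(\cdot)$ weakly as $u\to\infty$. A function $L$ is slowly varying if $L(\lambda u)/L(u)\to1$ as $u\to\infty$ for all $\lambda>0$. *)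

theory Defs
  imports "HOL-Probability.Probability"
begin

section \<open>Orthonormal bases\<close>

definition orthonormal_set :: "'h::real_inner set \<Rightarrow> bool" where
  "orthonormal_set B \<longleftrightarrow> (\<forall>e\<in>B. norm e = 1) \<and> pairwise orthogonal B"

definition is_onb :: "'h::real_inner set \<Rightarrow> bool" where
  "is_onb B \<longleftrightarrow> orthonormal_set B \<and> closure (span B) = UNIV"

lemma orthonormal_inner:
  assumes "orthonormal_set B" "e \<in> B" "f \<in> B"
  shows "inner e f = (if e = f then 1 else 0)"
  using assms by (auto simp: orthonormal_set_def pairwise_def orthogonal_def dot_square_norm)

lemma norm_sum_orthonormal:
  assumes "orthonormal_set B" "finite F" "F \<subseteq> B"
  shows "(norm (\<Sum>e\<in>F. c e *\<^sub>R e))\<^sup>2 = (\<Sum>e\<in>F. (c e)\<^sup>2)"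
proof -
  have "(norm (\<Sum>e\<in>F. c e *\<^sub>R e))\<^sup>2 = (\<Sum>e\<in>F. \<Sum>f\<in>F. c e * (c f * inner e f))"
    by (simp only: power2_norm_eq_inner inner_sum_left) (simp add: inner_sum_right sum_distrib_left mult.left_commute)
  also have "\<dots> = (\<Sum>e\<in>F. \<Sum>f\<in>F. if e = f then c e * c f else 0)"
    using assms by (intro sum.cong refl) (auto simp: orthonormal_inner subset_iff)
  also have "\<dots> = (\<Sum>e\<in>F. (c e)\<^sup>2)"
    using assms by (simp add: power2_eq_square)
  finally show ?thesis .
qed

lemma orthonormal_coeff_sum:
  assumes "orthonormal_set B" "finite F" "F \<subseteq> B" "f \<in> B"
  shows "inner (\<Sum>e\<in>F. c e *\<^sub>R e) f = (if f \<in> F then c f else 0)"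
proof -
  have "inner (\<Sum>e\<in>F. c e *\<^sub>R e) f = (\<Sum>e\<in>F. c e * inner e f)"
    by (simp add: inner_sum_left)
  also have "\<dots> = (\<Sum>e\<in>F. if e = f then c e else 0)"
    using assms by (intro sum.cong refl) (auto simp: orthonormal_inner subset_iff)
  also have "\<dots> = (if f \<in> F then c f else 0)"
    using assms by simp
  finally show ?thesis .
qed

lemma bessel:
  assumes "orthonormal_set B" "finite F" "F \<subseteq> B"
  shows "(\<Sum>e\<in>F. (inner x e)\<^sup>2) \<le> (norm x)\<^sup>2"
proof -
  let ?p = "\<Sum>e\<in>F. inner x e *\<^sub>R e"
  have "0 \<le> (norm (x - ?p))\<^sup>2" by simp
  also have "\<dots> = (norm x)\<^sup>2 - 2 * inner x ?p + (norm ?p)\<^sup>2"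
    by (simp add: power2_norm_eq_inner algebra_simps inner_commute)
  also have "inner x ?p = (\<Sum>e\<in>F. (inner x e)\<^sup>2)"
    by (simp add: inner_sum_right power2_eq_square)
  also have "(norm ?p)\<^sup>2 = (\<Sum>e\<in>F. (inner x e)\<^sup>2)"
    using norm_sum_orthonormal[OF assms, of "\<lambda>e. inner x e"] .
  finally show ?thesis by simp
qed

text \<open>Gram--Schmidt applied to a countable dense set.\<close>

lemma orthonormal_extend:
  fixes d :: "'h::real_inner"
  assumes B: "orthonormal_set B" "finite B"
  shows "\<exists>B'. orthonormal_set B' \<and> finite B' \<and> B \<subseteq> B' \<and> d \<in> span B'"
proof (cases "d \<in> span B")
  case True then show ?thesis using B by blast
next
  case False
  define p where "p = (\<Sum>e\<in>B. inner d e *\<^sub>R e)"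
  define r where "r = d - p"
  have p: "p \<in> span B" unfolding p_def by (intro span_sum span_scale span_base)
  have r0: "r \<noteq> 0" using False p by (auto simp: r_def)
  have ro: "inner r e = 0" if "e \<in> B" for e
    using orthonormal_coeff_sum[OF B(1,2) subset_refl that, of "\<lambda>e. inner d e"] that
    by (simp add: r_def p_def inner_diff_left)
  define u where "u = r /\<^sub>R norm r"
  have "orthonormal_set (insert u B)"
    using B(1) r0 ro by (auto simp: orthonormal_set_def pairwise_insert orthogonal_def u_def inner_commute)
  moreover have "d = p + norm r *\<^sub>R u" using r0 by (simp add: u_def r_def)
  hence "d \<in> span (insert u B)"
    using p by (metis insertI1 span_add span_base span_mono span_scale subsetD subset_insertI)
  ultimately show ?thesis using B(2) by (intro exI[of _ "insert u B"]) auto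
qed

lemma onb_exists: "\<exists>B::'h::{real_inner, second_countable_topology} set. is_onb B \<and> countable B"
proof -
  obtain D :: "'h set" where D: "countable D" "\<And>U. open U \<Longrightarrow> U \<noteq> {} \<Longrightarrow> \<exists>d\<in>D. d \<in> U"
    by (rule countable_dense_setE) blast
  have Dne: "D \<noteq> {}" using D(2)[of UNIV] by auto
  define d where "d = from_nat_into D"
  have rd: "range d = D" using D(1) Dne by (simp add: d_def range_from_nat_into)
  define P where "P = (\<lambda>(n::nat) S. orthonormal_set S \<and> finite (S::'h set))"
  have "\<exists>f. \<forall>n. P n (f n) \<and> (f n \<subseteq> f (Suc n) \<and> d n \<in> span (f (Suc n)))"
  proof (rule dependent_nat_choice)
    show "\<exists>S. P 0 S" by (intro exI[of _ "{}"]) (auto simp: P_def orthonormal_set_def)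
    fix S n assume "P n S"
    thus "\<exists>S'. P (Suc n) S' \<and> S \<subseteq> S' \<and> d n \<in> span S'"
      using orthonormal_extend[of S "d n"] by (auto simp: P_def)
  qed
  then obtain f where f: "\<And>n. P n (f n)" "\<And>n. f n \<subseteq> f (Suc n)" "\<And>n. d n \<in> span (f (Suc n))"
    by blast
  have mono: "f m \<subseteq> f n" if "m \<le> n" for m n
    using lift_Suc_mono_le[of f, OF f(2) that] .
  let ?B = "\<Union>n. f n"
  have pw: "orthogonal x y" if "x \<in> f m" "y \<in> f n" "x \<noteq> y" for x y m n
  proof -
    have "x \<in> f (max m n)" "y \<in> f (max m n)" using mono that by (meson max.cobounded1 max.cobounded2 subsetD)+
    thus ?thesis using f(1)[of "max m n"] that(3) by (auto simp: P_def orthonormal_set_def pairwise_def)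
  qed
  have "orthonormal_set ?B"
    using f(1) pw by (auto simp: orthonormal_set_def P_def pairwise_def)
  moreover have "D \<subseteq> span ?B"
  proof
    fix x assume "x \<in> D"
    then obtain n where "x = d n" using rd by auto
    thus "x \<in> span ?B" using f(3)[of n] span_mono[of "f (Suc n)" ?B] by blast
  qed
  hence "closure (span ?B) = UNIV"
    using D(2) unfolding closure_iff_nhds_not_empty set_eq_iff by (metis (no_types, lifting) UNIV_I IntI closure_iff_nhds_not_empty disjoint_iff empty_iff subsetD)
  moreover have "countable ?B" using f(1) by (auto simp: P_def intro: countable_finite)
  ultimately show ?thesis by (auto simp: is_onb_def)
qed

lemma onb_operator_bound:
  assumes B: "is_onb B" and A: "bounded_linear A" and K: "0 \<le> K"
    and le: "\<And>F. finite F \<Longrightarrow> F \<subseteq> B \<Longrightarrow> (\<Sum>e\<in>F. (norm (A e))\<^sup>2) \<le> K\<^sup>2"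
  shows "norm (A x) \<le> K * norm x"
proof -
  interpret A: bounded_linear A by fact
  have o: "orthonormal_set B" using B by (simp add: is_onb_def)
  have fin: "norm (A y) \<le> K * norm y" if y: "y = (\<Sum>e\<in>F. c e *\<^sub>R e)" and F: "finite F" "F \<subseteq> B" for y F c
  proof -
    have "norm (A y) \<le> (\<Sum>e\<in>F. \<bar>c e\<bar> * norm (A e))"
      unfolding y by (simp add: A.sum A.scale sum_norm_le)
    also have "\<dots> \<le> L2_set c F * L2_set (\<lambda>e. norm (A e)) F"
      using L2_set_mult_ineq[of c "\<lambda>e. norm (A e)" F] by simp
    also have "\<dots> \<le> L2_set c F * K"
    proof (rule mult_left_mono)
      show "L2_set (\<lambda>e. norm (A e)) F \<le> K"
        unfolding L2_set_def using le[OF F] K by (simp add: real_le_lsqrt sum_nonneg)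
    qed simp
    also have "L2_set c F = norm y"
      by (simp add: L2_set_def y flip: norm_sum_orthonormal[OF o F, of c])
    finally show ?thesis by (simp add: mult.commute)
  qed
  have "x \<in> closure (span B)" using B by (simp add: is_onb_def)
  then obtain y where y: "\<And>n. y n \<in> span B" "y \<longlonglongrightarrow> x"
    unfolding closure_sequential by blast
  have "norm (A (y n)) \<le> K * norm (y n)" for n
    using y(1)[of n] fin by (force simp: span_explicit)
  moreover have "(\<lambda>n. norm (A (y n))) \<longlonglongrightarrow> norm (A x)"
    by (intro tendsto_norm A.tendsto y(2))
  moreover have "(\<lambda>n. K * norm (y n)) \<longlonglongrightarrow> K * norm x"
    by (intro tendsto_intros y(2))
  ultimately show ?thesis by (meson LIMSEQ_le)
qed


section \<open>The Hilbert space of Hilbert--Schmidt operators\<close>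

text \<open>The Hilbert--Schmidt condition, inner product and norm are computed in a fixed orthonormal
  basis. As is well known, none of them depends on which basis is chosen.\<close>

definition hs_basis :: "'h::{real_inner, banach, second_countable_topology} set" where
  "hs_basis = (SOME B. is_onb B \<and> countable B)"

lemma hs_basis: "is_onb hs_basis" "countable hs_basis" "orthonormal_set hs_basis"
  using someI_ex[OF onb_exists] by (auto simp: hs_basis_def is_onb_def)

definition hilbert_schmidt ::
    "('h::{real_inner, banach, second_countable_topology} \<Rightarrow> 'h) \<Rightarrow> bool" where
  "hilbert_schmidt A \<longleftrightarrow>
     bounded_linear A \<and> (\<lambda>e. (norm (A e))\<^sup>2) summable_on hs_basis"

lemma hilbert_schmidtI:
  assumes "bounded_linear A"
    and "\<And>F. finite F \<Longrightarrow> F \<subseteq> hs_basis \<Longrightarrow> (\<Sum>e\<in>F. (norm (A e))\<^sup>2) \<le> K"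
  shows "hilbert_schmidt A"
  unfolding hilbert_schmidt_def using assms
  by (intro conjI nonneg_bdd_above_summable_on) (auto simp: bdd_above_def)

lemma hilbert_schmidt_zero: "hilbert_schmidt (\<lambda>_. 0)"
  by (simp add: hilbert_schmidt_def)

lemma hilbert_schmidt_add:
  assumes A: "hilbert_schmidt A" and A': "hilbert_schmidt A'"
  shows "hilbert_schmidt (\<lambda>x. A x + A' x)"
proof (rule hilbert_schmidtI)
  show "bounded_linear (\<lambda>x. A x + A' x)"
    using assms by (auto simp: hilbert_schmidt_def intro: bounded_linear_add)
  fix F assume F: "finite F" "F \<subseteq> (hs_basis :: 'a set)"
  have "(norm (a + b))\<^sup>2 \<le> 2 * (norm a)\<^sup>2 + 2 * (norm b)\<^sup>2" for a b :: 'a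
    using zero_le_power2[of "norm (a - b)"]
    by (simp add: power2_norm_eq_inner inner_add inner_diff inner_commute)
  hence "(\<Sum>e\<in>F. (norm (A e + A' e))\<^sup>2)
      \<le> 2 * (\<Sum>e\<in>F. (norm (A e))\<^sup>2) + 2 * (\<Sum>e\<in>F. (norm (A' e))\<^sup>2)"
    by (simp add: sum_distrib_left sum_mono flip: sum.distrib)
  also have "\<dots> \<le> 2 * (\<Sum>\<^sub>\<infinity>e\<in>hs_basis. (norm (A e))\<^sup>2) + 2 * (\<Sum>\<^sub>\<infinity>e\<in>hs_basis. (norm (A' e))\<^sup>2)"
    using A A' F by (intro add_mono mult_left_mono finite_sum_le_infsum) (auto simp: hilbert_schmidt_def)
  finally show "(\<Sum>e\<in>F. (norm (A e + A' e))\<^sup>2) \<le> \<dots>" .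
qed

lemma hilbert_schmidt_scaleR:
  assumes "hilbert_schmidt A" shows "hilbert_schmidt (\<lambda>x. c *\<^sub>R A x)"
proof -
  have "(\<lambda>e. c\<^sup>2 * (norm (A e))\<^sup>2) summable_on hs_basis"
    using assms by (intro summable_on_cmult_right) (simp add: hilbert_schmidt_def)
  moreover have "bounded_linear (\<lambda>x. c *\<^sub>R A x)"
    using assms by (intro bounded_linear_const_scaleR) (simp add: hilbert_schmidt_def)
  ultimately show ?thesis by (simp add: hilbert_schmidt_def power_mult_distrib)
qed

text \<open>The operator \<open>y \<otimes> z\<close>.\<close>

lemma hilbert_schmidt_tensor: "hilbert_schmidt (\<lambda>x. inner y x *\<^sub>R z)"
proof (rule hilbert_schmidtI)
  show "bounded_linear (\<lambda>x. inner y x *\<^sub>R z)"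
    by (intro bounded_linear_scaleR_const bounded_linear_inner_right)
  fix F assume F: "finite F" "F \<subseteq> (hs_basis :: 'a set)"
  have "(\<Sum>e\<in>F. (norm (inner y e *\<^sub>R z))\<^sup>2) = (\<Sum>e\<in>F. (inner y e)\<^sup>2) * (norm z)\<^sup>2"
    by (simp add: power_mult_distrib sum_distrib_right)
  also have "\<dots> \<le> (norm y)\<^sup>2 * (norm z)\<^sup>2"
    using bessel[OF hs_basis(3) F, of y] by (simp add: mult_right_mono)
  finally show "(\<Sum>e\<in>F. (norm (inner y e *\<^sub>R z))\<^sup>2) \<le> (norm y)\<^sup>2 * (norm z)\<^sup>2" .
qed

typedef (overloaded) 'h hs =
  "{A :: 'h::{real_inner, banach, second_countable_topology} \<Rightarrow> 'h. hilbert_schmidt A}"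
  morphisms hs_apply Hs
  using hilbert_schmidt_zero by blast

setup_lifting type_definition_hs

lemma hs_apply_hilbert_schmidt: "hilbert_schmidt (hs_apply A)"
  using hs_apply[of A] by simp

lemma hs_apply_bounded_linear: "bounded_linear (hs_apply A)"
  using hs_apply_hilbert_schmidt by (auto simp: hilbert_schmidt_def)

lemma hs_apply_summable: "(\<lambda>e. (norm (hs_apply A e))\<^sup>2) summable_on hs_basis"
  using hs_apply_hilbert_schmidt by (auto simp: hilbert_schmidt_def)

lift_definition tensor ::
    "'h::{real_inner, banach, second_countable_topology} \<Rightarrow> 'h \<Rightarrow> 'h hs" (infixr "\<otimes>\<^sub>S" 75)
  is "\<lambda>y z x. inner y x *\<^sub>R z"
  by (rule hilbert_schmidt_tensor)

instantiation hs :: ("{real_inner, banach, second_countable_topology}") real_vector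
begin

lift_definition zero_hs :: "'a hs" is "\<lambda>_. 0" by (rule hilbert_schmidt_zero)
lift_definition plus_hs :: "'a hs \<Rightarrow> 'a hs \<Rightarrow> 'a hs" is "\<lambda>A A' x. A x + A' x"
  by (rule hilbert_schmidt_add)
lift_definition scaleR_hs :: "real \<Rightarrow> 'a hs \<Rightarrow> 'a hs" is "\<lambda>c A x. c *\<^sub>R A x"
  by (rule hilbert_schmidt_scaleR)
definition uminus_hs :: "'a hs \<Rightarrow> 'a hs" where "uminus_hs A = (-1) *\<^sub>R A"
definition minus_hs :: "'a hs \<Rightarrow> 'a hs \<Rightarrow> 'a hs" where "minus_hs A A' = A + (-1) *\<^sub>R A'"

instance
  by standard (simp_all flip: hs_apply_inject add: fun_eq_iff uminus_hs_def minus_hs_def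
      zero_hs.rep_eq plus_hs.rep_eq scaleR_hs.rep_eq algebra_simps)

end

lemma hs_apply_simps [simp]:
  "hs_apply 0 x = 0"
  "hs_apply (A + A') x = hs_apply A x + hs_apply A' x"
  "hs_apply (c *\<^sub>R A) x = c *\<^sub>R hs_apply A x"
  "hs_apply (- A) x = - hs_apply A x"
  "hs_apply (A - A') x = hs_apply A x - hs_apply A' x"
  "hs_apply (y \<otimes>\<^sub>S z) x = inner y x *\<^sub>R z"
  unfolding uminus_hs_def minus_hs_def zero_hs.rep_eq plus_hs.rep_eq scaleR_hs.rep_eq tensor.rep_eq
  by simp_all

lemma hs_inner_summable: "(\<lambda>e. inner (hs_apply A e) (hs_apply A' e)) summable_on hs_basis"
proof (rule Infinite_Sum.abs_summable_summable, rule Infinite_Sum.abs_summable_on_comparison_test')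
  show "(\<lambda>e. (norm (hs_apply A e))\<^sup>2 + (norm (hs_apply A' e))\<^sup>2) summable_on hs_basis"
    by (intro summable_on_add hs_apply_summable)
  fix e :: 'a
  have "norm (inner (hs_apply A e) (hs_apply A' e)) \<le> norm (hs_apply A e) * norm (hs_apply A' e)"
    by (simp add: Cauchy_Schwarz_ineq2)
  also have "\<dots> \<le> (norm (hs_apply A e))\<^sup>2 + (norm (hs_apply A' e))\<^sup>2"
    using sum_squares_bound[of "norm (hs_apply A e)" "norm (hs_apply A' e)"]
    mult_nonneg_nonneg[OF norm_ge_zero[of "hs_apply A e"] norm_ge_zero[of "hs_apply A' e"]]
    by linarith
  finally show "norm (inner (hs_apply A e) (hs_apply A' e)) \<le> \<dots>" .
qed

instantiation hs :: ("{real_inner, banach, second_countable_topology}") real_inner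
begin

definition inner_hs :: "'a hs \<Rightarrow> 'a hs \<Rightarrow> real" where
  "inner_hs A A' = (\<Sum>\<^sub>\<infinity>e\<in>hs_basis. inner (hs_apply A e) (hs_apply A' e))"
definition norm_hs :: "'a hs \<Rightarrow> real" where
  "norm_hs A = sqrt (\<Sum>\<^sub>\<infinity>e\<in>hs_basis. (norm (hs_apply A e))\<^sup>2)"
definition sgn_hs :: "'a hs \<Rightarrow> 'a hs" where "sgn_hs A = A /\<^sub>R norm A"
definition dist_hs :: "'a hs \<Rightarrow> 'a hs \<Rightarrow> real" where "dist_hs A A' = norm (A - A')"
definition uniformity_hs :: "('a hs \<times> 'a hs) filter" where
  "uniformity_hs = (INF e\<in>{0<..}. principal {(x, y). dist x y < e})"
definition open_hs :: "'a hs set \<Rightarrow> bool" where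
  "open_hs U \<longleftrightarrow> (\<forall>x\<in>U. \<forall>\<^sub>F (x', y) in uniformity. x' = x \<longrightarrow> y \<in> U)"

instance
proof
  fix A A' A'' :: "'a hs" and r :: real
  show "dist A A' = norm (A - A')" by (rule dist_hs_def)
  show "sgn A = A /\<^sub>R norm A" by (rule sgn_hs_def)
  show "uniformity = (INF e\<in>{0<..}. principal {(x :: 'a hs, y). dist x y < e})"
    by (rule uniformity_hs_def)
  show "open U \<longleftrightarrow> (\<forall>x\<in>U. \<forall>\<^sub>F (x', y) in uniformity. x' = x \<longrightarrow> y \<in> U)" for U :: "'a hs set"
    by (rule open_hs_def)
  show "inner A A' = inner A' A" by (simp add: inner_hs_def inner_commute)
  show "inner (A + A') A'' = inner A A'' + inner A' A''"
    by (simp add: inner_hs_def inner_add_left infsum_add hs_inner_summable)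
  show "inner (r *\<^sub>R A) A' = r * inner A A'"
    by (simp add: inner_hs_def infsum_cmult_right')
  show ge: "0 \<le> inner A A" by (simp add: inner_hs_def infsum_nonneg)
  show "norm A = sqrt (inner A A)" by (simp add: norm_hs_def inner_hs_def power2_norm_eq_inner)
  show "inner A A = 0 \<longleftrightarrow> A = 0"
  proof
    assume 0: "inner A A = 0"
    have sum0: "(\<Sum>e\<in>F. (norm (hs_apply A e))\<^sup>2) \<le> 0\<^sup>2" if "finite F" "F \<subseteq> hs_basis" for F
      using finite_sum_le_infsum[OF hs_apply_summable that, of A] 0
      by (simp add: inner_hs_def power2_norm_eq_inner)
    have "hs_apply A x = 0" for x
      using onb_operator_bound[OF hs_basis(1) hs_apply_bounded_linear[of A], of 0 x] sum0 by simp
    hence "hs_apply A = hs_apply 0" by (simp add: fun_eq_iff)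
    thus "A = 0" by (simp only: hs_apply_inject)
  next
    assume "A = 0"
    thus "inner A A = 0" by (simp add: inner_hs_def)
  qed
qed

end

lemma hs_sum_le_norm:
  assumes "finite F" "F \<subseteq> hs_basis"
  shows "(\<Sum>e\<in>F. (norm (hs_apply A e))\<^sup>2) \<le> (norm A)\<^sup>2"
  using finite_sum_le_infsum[OF hs_apply_summable assms, of A]
  by (simp add: norm_hs_def infsum_nonneg)

lemma hs_norm_le:
  assumes "0 \<le> K" "\<And>F. finite F \<Longrightarrow> F \<subseteq> hs_basis \<Longrightarrow> (\<Sum>e\<in>F. (norm (hs_apply A e))\<^sup>2) \<le> K\<^sup>2"
  shows "norm A \<le> K"
  unfolding norm_hs_def
  using infsum_le_finite_sums[OF hs_apply_summable, of A "K\<^sup>2"] assms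
  by (intro real_le_lsqrt) auto

lemma hs_operator_norm_le: "norm (hs_apply A x) \<le> norm A * norm x"
  by (rule onb_operator_bound[OF hs_basis(1) hs_apply_bounded_linear norm_ge_zero hs_sum_le_norm])

instance hs :: ("{real_inner, banach, second_countable_topology}") banach
proof
  fix A :: "nat \<Rightarrow> 'a hs" assume C: "Cauchy A"
  have "Cauchy (\<lambda>n. hs_apply (A n) x)" for x
  proof (rule metric_CauchyI)
    fix \<epsilon> :: real assume "0 < \<epsilon>"
    hence "0 < \<epsilon> / (norm x + 1)" by (simp add: add_nonneg_pos)
    from CauchyD[OF C this] obtain M where M: "\<And>m n. m \<ge> M \<Longrightarrow> n \<ge> M \<Longrightarrow> norm (A m - A n) < \<epsilon> / (norm x + 1)" by blast
    have "dist (hs_apply (A m) x) (hs_apply (A n) x) < \<epsilon>" if "m \<ge> M" "n \<ge> M" for m n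
    proof -
      have "dist (hs_apply (A m) x) (hs_apply (A n) x) \<le> norm (A m - A n) * norm x"
        using hs_operator_norm_le[of "A m - A n" x] by (simp add: dist_norm)
      also have "\<dots> \<le> norm (A m - A n) * (norm x + 1)" by (simp add: mult_left_mono)
      also have "\<dots> < \<epsilon>" using M[OF that] by (subst (asm) pos_less_divide_eq) (simp_all add: add_nonneg_pos)
      finally show ?thesis .
    qed
    thus "\<exists>M. \<forall>m\<ge>M. \<forall>n\<ge>M. dist (hs_apply (A m) x) (hs_apply (A n) x) < \<epsilon>" by blast
  qed
  hence "\<exists>T. \<forall>x. (\<lambda>n. hs_apply (A n) x) \<longlonglongrightarrow> T x"
    unfolding Cauchy_convergent_iff convergent_def by (rule choice[OF allI])
  then obtain T where T: "\<And>x. (\<lambda>n. hs_apply (A n) x) \<longlonglongrightarrow> T x" by blast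
  obtain K where K: "\<And>n. norm (A n) \<le> K"
    using Cauchy_Bseq[OF C] by (auto simp: Bseq_def)
  have lin: "hs_apply (A n) (x + y) = hs_apply (A n) x + hs_apply (A n) y"
    "hs_apply (A n) (c *\<^sub>R x) = c *\<^sub>R hs_apply (A n) x" for n x y c
    using bounded_linear.linear[OF hs_apply_bounded_linear[of "A n"]]
    by (simp_all only: linear_add linear_scale)
  have bl: "bounded_linear T"
  proof (rule bounded_linear_intro[where K = K])
    fix x y c
    show "T (x + y) = T x + T y"
      using LIMSEQ_unique[OF T[of "x + y"]] tendsto_add[OF T[of x] T[of y]] by (simp add: lin)
    show "T (c *\<^sub>R x) = c *\<^sub>R T x"
      using LIMSEQ_unique[OF T[of "c *\<^sub>R x"]] tendsto_scaleR[OF tendsto_const T[of x], of c] by (simp add: lin)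
    have "norm (hs_apply (A n) x) \<le> norm x * K" for n
      using hs_operator_norm_le[of "A n" x] mult_right_mono[OF K[of n] norm_ge_zero[of x]]
      by (simp add: mult.commute)
    thus "norm (T x) \<le> norm x * K"
      by (intro LIMSEQ_le_const2[OF tendsto_norm[OF T]]) auto
  qed
  have close: "\<exists>N. \<forall>n\<ge>N. \<forall>F. finite F \<longrightarrow> F \<subseteq> hs_basis \<longrightarrow>
      (\<Sum>e\<in>F. (norm (hs_apply (A n) e - T e))\<^sup>2) \<le> \<epsilon>\<^sup>2" if \<epsilon>: "0 < \<epsilon>" for \<epsilon>
  proof -
    from CauchyD[OF C \<epsilon>] obtain N
      where N: "\<And>m n. m \<ge> N \<Longrightarrow> n \<ge> N \<Longrightarrow> norm (A m - A n) < \<epsilon>" by blast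
    have "(\<Sum>e\<in>F. (norm (hs_apply (A n) e - T e))\<^sup>2) \<le> \<epsilon>\<^sup>2"
      if n: "n \<ge> N" and F: "finite F" "F \<subseteq> hs_basis" for n F
    proof (rule LIMSEQ_le_const2)
      show "(\<lambda>m. \<Sum>e\<in>F. (norm (hs_apply (A n) e - hs_apply (A m) e))\<^sup>2)
          \<longlonglongrightarrow> (\<Sum>e\<in>F. (norm (hs_apply (A n) e - T e))\<^sup>2)"
        by (intro tendsto_intros T)
      have "(\<Sum>e\<in>F. (norm (hs_apply (A n) e - hs_apply (A m) e))\<^sup>2) \<le> \<epsilon>\<^sup>2" if "m \<ge> N" for m
        using hs_sum_le_norm[OF F, of "A n - A m"] power_mono[OF less_imp_le[OF N[OF n that]], of 2]
        by simp
      thus "\<exists>N. \<forall>m\<ge>N. (\<Sum>e\<in>F. (norm (hs_apply (A n) e - hs_apply (A m) e))\<^sup>2) \<le> \<epsilon>\<^sup>2" by blast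
    qed
    thus ?thesis by blast
  qed
  obtain n where n: "\<And>F. finite F \<Longrightarrow> F \<subseteq> hs_basis \<Longrightarrow>
      (\<Sum>e\<in>F. (norm (hs_apply (A n) e - T e))\<^sup>2) \<le> 1\<^sup>2"
    using close[of 1] by auto
  have "hilbert_schmidt (\<lambda>x. hs_apply (A n) x - T x)"
    using n by (intro hilbert_schmidtI[where K = "1\<^sup>2"] bounded_linear_sub hs_apply_bounded_linear bl)
  from hilbert_schmidt_add[OF hs_apply_hilbert_schmidt[of "A n"] hilbert_schmidt_scaleR[OF this, of "-1"]]
  have "hilbert_schmidt T" by simp
  hence T_eq: "hs_apply (Hs T) = T" by (simp add: Hs_inverse)
  have "A \<longlonglongrightarrow> Hs T"
  proof (rule metric_LIMSEQ_I)
    fix \<epsilon> :: real assume "0 < \<epsilon>"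
    then obtain N where N: "\<forall>n\<ge>N. \<forall>F. finite F \<longrightarrow> F \<subseteq> hs_basis \<longrightarrow>
        (\<Sum>e\<in>F. (norm (hs_apply (A n) e - T e))\<^sup>2) \<le> (\<epsilon>/2)\<^sup>2"
      using close[of "\<epsilon>/2"] by auto
    have "norm (A n - Hs T) \<le> \<epsilon>/2" if "n \<ge> N" for n
      using N that \<open>0 < \<epsilon>\<close> by (intro hs_norm_le) (auto simp: T_eq)
    thus "\<exists>N. \<forall>n\<ge>N. dist (A n) (Hs T) < \<epsilon>"
      using \<open>0 < \<epsilon>\<close> by (force simp: dist_norm)
  qed
  thus "convergent A" by (rule convergentI)
qed

lemma hs_apply_sum: "hs_apply (sum f I) x = (\<Sum>i\<in>I. hs_apply (f i) x)"
  by (induction I rule: infinite_finite_induct) auto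

lemma hs_finite_rank_approx:
  fixes A :: "'h::{real_inner, banach, second_countable_topology} hs"
  assumes D: "\<And>U. open U \<Longrightarrow> U \<noteq> {} \<Longrightarrow> \<exists>d\<in>D. d \<in> U" and \<epsilon>: "0 < \<epsilon>"
  obtains F d where "finite F" "F \<subseteq> hs_basis" "\<And>e. e \<in> F \<Longrightarrow> d e \<in> D"
    "norm (A - (\<Sum>e\<in>F. e \<otimes>\<^sub>S d e)) < \<epsilon>"
proof -
  let ?S = "\<Sum>\<^sub>\<infinity>e\<in>hs_basis. (norm (hs_apply A e))\<^sup>2"
  define \<delta> where "\<delta> = \<epsilon>\<^sup>2 / 8"
  have \<delta>: "0 < \<delta>" using \<epsilon> by (simp add: \<delta>_def)
  obtain F where F: "finite F" "F \<subseteq> hs_basis" "dist (\<Sum>e\<in>F. (norm (hs_apply A e))\<^sup>2) ?S \<le> \<delta>"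
    using infsum_finite_approximation[OF hs_apply_summable \<delta>, of A] by auto
  define \<eta> where "\<eta> = sqrt (\<delta> / (real (card F) + 1))"
  have \<eta>: "0 < \<eta>" using \<delta> by (simp add: \<eta>_def add_nonneg_pos)
  have "\<exists>d\<in>D. d \<in> ball (hs_apply A e) \<eta>" for e
    using \<eta> by (intro D) auto
  then obtain d where d: "\<And>e. d e \<in> D" "\<And>e. norm (hs_apply A e - d e) < \<eta>"
    by (metis dist_norm mem_ball)
  let ?T = "\<Sum>e\<in>F. e \<otimes>\<^sub>S d e"
  have T: "hs_apply ?T e = (if e \<in> F then d e else 0)" if "e \<in> hs_basis" for e
  proof -
    have "hs_apply ?T e = (\<Sum>f\<in>F. if f = e then d f else 0)"
      unfolding hs_apply_sum
    proof (rule sum.cong)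
      fix f assume "f \<in> F"
      hence "inner f e = (if f = e then 1 else 0)"
        using F(2) that by (intro orthonormal_inner[OF hs_basis(3)]) auto
      thus "hs_apply (f \<otimes>\<^sub>S d f) e = (if f = e then d f else 0)" by simp
    qed simp
    thus ?thesis using F by simp
  qed
  have "norm (A - ?T) \<le> \<epsilon> / 2"
  proof (rule hs_norm_le)
    fix G assume G: "finite G" "G \<subseteq> (hs_basis :: 'h set)"
    have "(G - F) \<union> F = G \<union> F" "(G - F) \<inter> F = {}" by auto
    hence split: "sum g (G \<union> F) = sum g (G - F) + sum g F" for g :: "'h \<Rightarrow> real"
      using G F sum.union_disjoint[of "G - F" F g] by simp
    have "(\<Sum>e\<in>G. (norm (hs_apply (A - ?T) e))\<^sup>2) \<le> (\<Sum>e\<in>G \<union> F. (norm (hs_apply (A - ?T) e))\<^sup>2)"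
      using G F by (intro sum_mono2) auto
    also have "\<dots> = (\<Sum>e\<in>G - F. (norm (hs_apply (A - ?T) e))\<^sup>2) + (\<Sum>e\<in>F. (norm (hs_apply (A - ?T) e))\<^sup>2)"
      by (simp add: split)
    also have "(\<Sum>e\<in>G - F. (norm (hs_apply (A - ?T) e))\<^sup>2) = (\<Sum>e\<in>G - F. (norm (hs_apply A e))\<^sup>2)"
      using G T by (intro sum.cong) auto
    also have "(\<Sum>e\<in>G - F. (norm (hs_apply A e))\<^sup>2) \<le> \<delta>"
    proof -
      have "(\<Sum>e\<in>G - F. (norm (hs_apply A e))\<^sup>2) + (\<Sum>e\<in>F. (norm (hs_apply A e))\<^sup>2)
          = (\<Sum>e\<in>G \<union> F. (norm (hs_apply A e))\<^sup>2)"
        by (simp add: split)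
      also have "\<dots> \<le> ?S"
        using G F by (intro finite_sum_le_infsum hs_apply_summable) auto
      finally show ?thesis using F(3) by (simp add: dist_real_def)
    qed
    also have "(\<Sum>e\<in>F. (norm (hs_apply (A - ?T) e))\<^sup>2) \<le> (\<Sum>e\<in>F. \<eta>\<^sup>2)"
      using F T d(2) by (intro sum_mono power_mono) (auto simp: subset_iff less_imp_le)
    also have "\<dots> \<le> \<delta>"
      using \<delta> by (simp add: \<eta>_def field_simps)
    also have "\<delta> + \<delta> = (\<epsilon> / 2)\<^sup>2" by (simp add: \<delta>_def power_divide)
    finally show "(\<Sum>e\<in>G. (norm (hs_apply (A - ?T) e))\<^sup>2) \<le> (\<epsilon> / 2)\<^sup>2" by simp
  qed (use \<epsilon> in simp)
  hence "norm (A - ?T) < \<epsilon>" using \<epsilon> by simp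
  with F d(1) that show ?thesis by blast
qed

instance hs :: ("{real_inner, banach, second_countable_topology}") second_countable_topology
proof
  obtain D :: "'a set" where D: "countable D" "\<And>U. open U \<Longrightarrow> U \<noteq> {} \<Longrightarrow> \<exists>d\<in>D. d \<in> U"
    by (rule countable_dense_setE) blast
  define R where "R = (\<lambda>xs. \<Sum>(e, d)\<leftarrow>xs. e \<otimes>\<^sub>S d) ` lists (hs_basis \<times> D)"
  have R: "countable R"
    unfolding R_def using D(1) hs_basis(2) by blast
  have dense: "\<exists>r\<in>R. dist A r < \<epsilon>" if "0 < \<epsilon>" for A :: "'a hs" and \<epsilon>
  proof -
    obtain F d where F: "finite F" "F \<subseteq> hs_basis" "\<And>e. e \<in> F \<Longrightarrow> d e \<in> D"
      "norm (A - (\<Sum>e\<in>F. e \<otimes>\<^sub>S d e)) < \<epsilon>"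
      using hs_finite_rank_approx[OF D(2) \<open>0 < \<epsilon>\<close>, of A] by blast
    obtain es where es: "set es = F" "distinct es" using finite_distinct_list[OF F(1)] by blast
    have "(\<Sum>e\<in>F. e \<otimes>\<^sub>S d e) = (\<Sum>(e, d)\<leftarrow>map (\<lambda>e. (e, d e)) es. e \<otimes>\<^sub>S d)"
      using es by (simp add: sum_list_distinct_conv_sum_set o_def)
    moreover have "map (\<lambda>e. (e, d e)) es \<in> lists (hs_basis \<times> D)"
      using F es by auto
    ultimately have "(\<Sum>e\<in>F. e \<otimes>\<^sub>S d e) \<in> R"
      unfolding R_def by blast
    thus ?thesis using F(4) by (auto simp: dist_norm)
  qed
  define \<B> where "\<B> = (\<lambda>(r, q). ball r (real_of_rat q)) ` (R \<times> {0<..})"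
  have "topological_basis \<B>"
  proof (rule topological_basisI)
    show "open U" if "U \<in> \<B>" for U using that by (auto simp: \<B>_def)
    fix U and A :: "'a hs" assume "open U" "A \<in> U"
    then obtain \<epsilon> where \<epsilon>: "0 < \<epsilon>" "ball A \<epsilon> \<subseteq> U" using open_contains_ball by blast
    obtain q where q: "0 < real_of_rat q" "real_of_rat q < \<epsilon> / 2"
      using of_rat_dense[of 0 "\<epsilon> / 2"] \<epsilon>(1) by auto
    obtain r where r: "r \<in> R" "dist A r < real_of_rat q" using dense[OF q(1)] by blast
    have "ball r (real_of_rat q) \<subseteq> ball A \<epsilon>"
    proof
      fix z assume "z \<in> ball r (real_of_rat q)"
      thus "z \<in> ball A \<epsilon>" using r(2) q(2) dist_triangle[of A z r] by simp
    qed
    thus "\<exists>V\<in>\<B>. A \<in> V \<and> V \<subseteq> U"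
      using r q \<epsilon> by (intro bexI[of _ "ball r (real_of_rat q)"]) (auto simp: \<B>_def dist_commute)
  qed
  moreover have "countable \<B>" using R by (auto simp: \<B>_def)
  ultimately show "\<exists>B::'a hs set set. countable B \<and> open = generate_topology B"
    using topological_basis_imp_subbasis by blast
qed


section \<open>The space of square integrable functions on a set\<close>

definition square_integrable_on :: "('e::euclidean_space \<Rightarrow> real) \<Rightarrow> 'e set \<Rightarrow> bool"
    (infixr "square'_integrable'_on" 46) where
  "f square_integrable_on T \<longleftrightarrow>
     f \<in> borel_measurable (lebesgue_on T) \<and> integrable (lebesgue_on T) (\<lambda>t. (f t)\<^sup>2)"

text \<open>The space \<open>L\<^sup>2(T)\<close> depends on the set \<open>T\<close>, so it cannot itself be a type. Instead,
  \<open>is_L2 T cls\<close> states that the type \<open>'h\<close> is the quotient of the square integrable functions on \<open>T\<close>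
  by equality almost everywhere on \<open>T\<close>, with its usual vector space operations and inner product,
  where \<open>cls f\<close> is the class of \<open>f\<close>. The values of \<open>cls\<close> at other functions are irrelevant.\<close>

definition is_L2 :: "'e::euclidean_space set \<Rightarrow> (('e \<Rightarrow> real) \<Rightarrow> 'h::real_inner) \<Rightarrow> bool" where
  "is_L2 T cls \<longleftrightarrow>
     cls ` {f. f square_integrable_on T} = UNIV \<and>
     (\<forall>f g. f square_integrable_on T \<longrightarrow> g square_integrable_on T \<longrightarrow>
        (cls f = cls g \<longleftrightarrow> (AE t in lebesgue_on T. f t = g t)) \<and>
        cls f + cls g = cls (\<lambda>t. f t + g t) \<and>
        (\<forall>c. c *\<^sub>R cls f = cls (\<lambda>t. c * f t)) \<and>
        inner (cls f) (cls g) = (\<integral>t. f t * g t \<partial>lebesgue_on T))"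

section \<open>Regular variation\<close>

definition slowly_varying :: "(real \<Rightarrow> real) \<Rightarrow> bool" where
  "slowly_varying L \<longleftrightarrow> (\<forall>c>0. ((\<lambda>u. L (c * u) / L u) \<longlongrightarrow> 1) at_top)"

definition weakly_converges ::
    "('i \<Rightarrow> 'b::topological_space measure) \<Rightarrow> 'b measure \<Rightarrow> 'i filter \<Rightarrow> bool" where
  "weakly_converges \<mu> \<nu> F \<longleftrightarrow>
     (\<forall>f::'b \<Rightarrow> real. continuous_on UNIV f \<and> bounded (range f) \<longrightarrow>
        ((\<lambda>i. \<integral>x. f x \<partial>\<mu> i) \<longlongrightarrow> (\<integral>x. f x \<partial>\<nu>)) F)"

text \<open>The law of \<open>X / \<parallel>X\<parallel>\<close> given \<open>\<parallel>X\<parallel> > u\<close>. The library's \<open>uniform_measure M A\<close> is the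
  conditional measure \<open>M(\<cdot> | A)\<close>.\<close>

definition angular_law ::
    "'a measure \<Rightarrow> ('a \<Rightarrow> 'b::real_normed_vector) \<Rightarrow> real \<Rightarrow> 'b measure" where
  "angular_law M X u =
     distr (uniform_measure M {\<omega> \<in> space M. norm (X \<omega>) > u}) borel (\<lambda>\<omega>. X \<omega> /\<^sub>R norm (X \<omega>))"

text \<open>A probability measure on the unit sphere is encoded as a Borel probability measure on the whole
  space that gives the (closed) sphere mass one; weak convergence is the same for both encodings.\<close>

definition regularly_varying ::
    "'a measure \<Rightarrow> ('a \<Rightarrow> 'b::{banach, second_countable_topology}) \<Rightarrow> real \<Rightarrow> bool" where
  "regularly_varying M X \<alpha> \<longleftrightarrow>
     \<alpha> > 0 \<and> X \<in> borel_measurable M \<and>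
     (\<exists>L. slowly_varying L \<and>
        (\<forall>u>0. measure M {\<omega> \<in> space M. norm (X \<omega>) > u} = u powr (- \<alpha>) * L u)) \<and>
     (\<exists>\<Gamma>. prob_space \<Gamma> \<and> sets \<Gamma> = sets borel \<and> measure \<Gamma> (sphere 0 1) = 1 \<and>
        weakly_converges (angular_law M X) \<Gamma> at_top)"

section \<open>Covariance operators and their eigenfunctions\<close>

definition covariance_operator ::
    "'a measure \<Rightarrow> ('a \<Rightarrow> 'h::{real_inner, banach, second_countable_topology}) \<Rightarrow> 'h hs" where
  "covariance_operator M X = (\<integral>\<omega>. X \<omega> \<otimes>\<^sub>S X \<omega> \<partial>M)"

definition empirical_covariance ::
    "(nat \<Rightarrow> 'a \<Rightarrow> 'h::{real_inner, banach, second_countable_topology}) \<Rightarrow> nat \<Rightarrow> 'a \<Rightarrow> 'h hs" where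
  "empirical_covariance Xs N \<omega> = (1 / real N) *\<^sub>R (\<Sum>n=1..N. Xs n \<omega> \<otimes>\<^sub>S Xs n \<omega>)"

text \<open>The sequence \<open>v\<close> (indexed from \<open>1\<close>) lists orthonormal eigenfunctions of \<open>C\<close> by decreasing
  eigenvalues, and it lists all of them, in the sense that every eigenfunction with a nonzero
  eigenvalue lies in their closed span. Eigenfunctions with eigenvalue \<open>0\<close> need not occur (they
  cannot when infinitely many eigenvalues are positive). If \<open>C = E[X \<otimes> X]\<close>, this completeness
  is equivalent to the expansion \<open>X = (\<Sum>j\<ge>1. \<langle>X, v j\<rangle> v j)\<close> holding almost surely.\<close>

definition ordered_eigenfunctions ::
    "'h::{real_inner, banach, second_countable_topology} hs \<Rightarrow> (nat \<Rightarrow> 'h) \<Rightarrow> bool" where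
  "ordered_eigenfunctions C v \<longleftrightarrow>
     (\<forall>i\<ge>1. \<forall>j\<ge>1. inner (v i) (v j) = (if i = j then 1 else 0)) \<and>
     (\<exists>l. (\<forall>j\<ge>1. hs_apply C (v j) = l j *\<^sub>R v j) \<and> (\<forall>i j. 1 \<le> i \<longrightarrow> i \<le> j \<longrightarrow> l j \<le> l i)) \<and>
     (\<forall>x c. c \<noteq> 0 \<and> hs_apply C x = c *\<^sub>R x \<longrightarrow> x \<in> closure (span (v ` {1..})))"

end

theory Submission
  imports Defs "HOL-Library.Discrete_Functions" "HOL-Real_Asymp.Real_Asymp"
begin

text \<open>
  The operators \<open>X\<^sub>n \<otimes> X\<^sub>n\<close> are independent copies of \<open>W = X \<otimes> X\<close>, a random element of the separable
  Hilbert space of Hilbert--Schmidt operators with mean \<open>C\<close> and \<open>\<parallel>W\<parallel> \<le> \<parallel>X\<parallel>\<^sup>2\<close>. A random element that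
  is regularly varying with index \<open>\<alpha>\<close> has finite norm moments of every order below \<open>\<alpha>\<close>
  (\<open>regularly_varying_integrable_powr\<close>), so \<open>E \<parallel>W\<parallel>\<^sup>p < \<infinity>\<close> for every \<open>p < \<alpha> / 2\<close>. The claim is therefore a
  strong law of Marcinkiewicz--Zygmund type, \<open>N\<^bsup>- 1 / \<gamma>\<^esup> \<parallel>\<Sum>\<^sub>n (X\<^sub>n \<otimes> X\<^sub>n - C)\<parallel> \<rightarrow> 0\<close>, for Hilbert space valued
  summands.

  Since \<open>\<gamma> < \<alpha> / 2 < 2\<close>, a moment order \<open>p\<close> strictly larger than \<open>\<gamma>\<close> and at most \<open>2\<close> is available, and
  this gain of a power makes the strong law (\<open>marcinkiewicz_zygmund_strong_law\<close>) accessible by second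
  moments. Fix \<open>q\<close> with \<open>\<gamma> < q < p\<close> and treat the first \<open>2\<^sup>k\<close> summands at once, truncated at
  \<open>\<tau> = 2\<^bsup>k / q\<^esup>\<close>. Truncation changes some summand with probability at most \<open>2\<^sup>k \<tau>\<^bsup>-p\<^esup> E \<parallel>W\<parallel>\<^sup>p\<close>, and it moves
  the mean by at most \<open>\<tau>\<^bsup>1 - p\<^esup> E \<parallel>W\<parallel>\<^sup>p\<close>. The centered truncated summands are orthogonal in \<open>L\<^sup>2\<close> with
  variance at most \<open>\<tau>\<^bsup>2 - p\<^esup> E \<parallel>W\<parallel>\<^sup>p\<close>, so their partial sums are controlled uniformly by the
  Rademacher--Menshov inequality (\<open>integral_dyadic_bound_le\<close>); its logarithmic loss is negligible against
  the gain from \<open>q < p\<close>. Altogether some partial sum exceeds a multiple of \<open>\<tau>\<close> with probability of order \<open>k\<^sup>2 2\<^bsup>k (1 - p / q)\<^esup>\<close> (\<open>prob_partial_sum_deviation_le\<close>), which is summable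
  in \<open>k\<close>, and the Borel--Cantelli lemma concludes.
\<close>

section \<open>A maximal inequality for orthogonal summands\<close>

text \<open>A majorant of \<open>max {\<parallel>z a + \<dots> + z (a + n - 1)\<parallel>\<^sup>2 | n \<le> 2\<^sup>k}\<close> built from squared norms of sums over dyadic
  blocks. Unlike the maximum it is a finite nonnegative combination of such squares, so its
  expectation can be computed term by term. The weights come from \<open>weighted_square_sum_le\<close> with
  \<open>t = k + 1\<close>; this choice makes the expectation grow like \<open>(k + 1)\<^sup>2\<close>, whereas the cruder
  \<open>(x + y)\<^sup>2 \<le> 2 x\<^sup>2 + 2 y\<^sup>2\<close> would cost a factor \<open>2\<^sup>k\<close>, that is, a whole power of the number of terms.\<close>
fun dyadic_bound :: "(nat \<Rightarrow> 'b::real_normed_vector) \<Rightarrow> nat \<Rightarrow> nat \<Rightarrow> real" where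
  "dyadic_bound z 0 a = (norm (z a))\<^sup>2"
| "dyadic_bound z (Suc k) a =
     dyadic_bound z k a
     + (real k + 2) * (norm (\<Sum>i=a..<a + 2 ^ k. z i))\<^sup>2
     + (real k + 2) / (real k + 1) * dyadic_bound z k (a + 2 ^ k)"

lemma dyadic_bound_nonneg: "0 \<le> dyadic_bound z k a"
  by (induction k arbitrary: a) auto

lemma weighted_square_sum_le:
  fixes x y t :: real
  assumes "0 < t"
  shows "(x + y)\<^sup>2 \<le> (1 + t) * x\<^sup>2 + (1 + 1 / t) * y\<^sup>2"
proof -
  have "0 \<le> (t * x - y)\<^sup>2 / t" using assms by simp
  also have "\<dots> = (1 + t) * x\<^sup>2 + (1 + 1 / t) * y\<^sup>2 - (x + y)\<^sup>2"
    using assms by (simp add: power2_eq_square field_simps)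
  finally show ?thesis by simp
qed

text \<open>A sum of more than \<open>2\<^sup>k\<close> terms splits into the full first half-block and a partial sum of the second
  half-block, to which the induction hypothesis applies.\<close>
lemma norm_partial_sum_le_dyadic_bound:
  assumes "n \<le> 2 ^ k"
  shows "(norm (\<Sum>i=a..<a + n. z i))\<^sup>2 \<le> dyadic_bound z k a"
  using assms
proof (induction k arbitrary: a n)
  case 0
  hence "n = 0 \<or> n = 1" by auto
  thus ?case by auto
next
  case (Suc k)
  show ?case
  proof (cases "n \<le> 2 ^ k")
    case True
    have "(norm (\<Sum>i=a..<a + n. z i))\<^sup>2 \<le> dyadic_bound z k a"
      by (rule Suc.IH[OF True])
    also have "\<dots> \<le> dyadic_bound z (Suc k) a"
      by (simp add: dyadic_bound_nonneg)
    finally show ?thesis .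
  next
    case False
    define r where "r = n - 2 ^ k"
    have r: "n = 2 ^ k + r" "r \<le> 2 ^ k" using False Suc.prems by (auto simp: r_def)
    let ?x = "\<Sum>i=a..<a + 2 ^ k. z i" and ?y = "\<Sum>i=a + 2 ^ k..<(a + 2 ^ k) + r. z i"
    have "(\<Sum>i=a..<a + n. z i) = ?x + ?y"
      unfolding r(1) by (subst sum.atLeastLessThan_concat) (auto simp: add.assoc)
    hence "(norm (\<Sum>i=a..<a + n. z i))\<^sup>2 \<le> (norm ?x + norm ?y)\<^sup>2"
      by (simp add: norm_triangle_ineq power_mono)
    also have "\<dots> \<le> (1 + (real k + 1)) * (norm ?x)\<^sup>2 + (1 + 1 / (real k + 1)) * (norm ?y)\<^sup>2"
      by (rule weighted_square_sum_le) simp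
    also have "\<dots> = (real k + 2) * (norm ?x)\<^sup>2 + (real k + 2) / (real k + 1) * (norm ?y)\<^sup>2"
      by (simp add: field_simps)
    also have "\<dots> \<le> (real k + 2) * (norm ?x)\<^sup>2
        + (real k + 2) / (real k + 1) * dyadic_bound z k (a + 2 ^ k)"
      by (intro add_left_mono mult_left_mono Suc.IH r) auto
    also have "\<dots> \<le> dyadic_bound z (Suc k) a" by (simp add: dyadic_bound_nonneg)
    finally show ?thesis .
  qed
qed

lemma integrable_inner_of_square:
  fixes U V :: "'a \<Rightarrow> 'b::{real_inner, second_countable_topology}"
  assumes [measurable]: "U \<in> borel_measurable M" "V \<in> borel_measurable M"
    and "integrable M (\<lambda>\<omega>. (norm (U \<omega>))\<^sup>2)" "integrable M (\<lambda>\<omega>. (norm (V \<omega>))\<^sup>2)"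
  shows "integrable M (\<lambda>\<omega>. inner (U \<omega>) (V \<omega>))"
proof (rule Bochner_Integration.integrable_bound)
  show "integrable M (\<lambda>\<omega>. (norm (U \<omega>))\<^sup>2 + (norm (V \<omega>))\<^sup>2)"
    using assms by simp
  have "\<bar>inner x y\<bar> \<le> (norm x)\<^sup>2 + (norm y)\<^sup>2" for x y :: 'b
  proof -
    have "\<bar>inner x y\<bar> \<le> norm x * norm y" by (rule Cauchy_Schwarz_ineq2)
    also have "\<dots> \<le> (norm x)\<^sup>2 + (norm y)\<^sup>2"
      using sum_squares_bound[of "norm x" "norm y"] mult_nonneg_nonneg[OF norm_ge_zero norm_ge_zero, of x y]
      by linarith
    finally show ?thesis .
  qed
  thus "AE \<omega> in M. norm (inner (U \<omega>) (V \<omega>)) \<le> norm ((norm (U \<omega>))\<^sup>2 + (norm (V \<omega>))\<^sup>2)"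
    by (intro AE_I2) simp
qed measurable

lemma
  fixes Z :: "nat \<Rightarrow> 'a \<Rightarrow> 'b::{real_inner, second_countable_topology}"
  assumes meas: "\<And>i. Z i \<in> borel_measurable M"
    and sq: "\<And>i. integrable M (\<lambda>\<omega>. (norm (Z i \<omega>))\<^sup>2)"
    and orth: "\<And>i j. i \<noteq> j \<Longrightarrow> (\<integral>\<omega>. inner (Z i \<omega>) (Z j \<omega>) \<partial>M) = 0"
    and "finite I"
  shows integrable_norm_sum_square: "integrable M (\<lambda>\<omega>. (norm (\<Sum>i\<in>I. Z i \<omega>))\<^sup>2)"
    and integral_norm_orthogonal_sum:
      "(\<integral>\<omega>. (norm (\<Sum>i\<in>I. Z i \<omega>))\<^sup>2 \<partial>M) = (\<Sum>i\<in>I. \<integral>\<omega>. (norm (Z i \<omega>))\<^sup>2 \<partial>M)"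
proof -
  have expand: "(norm (\<Sum>i\<in>I. Z i \<omega>))\<^sup>2 = (\<Sum>i\<in>I. \<Sum>j\<in>I. inner (Z i \<omega>) (Z j \<omega>))" for \<omega>
    unfolding power2_norm_eq_inner inner_sum_left
    by (intro sum.cong refl) (simp add: inner_sum_right)
  have int: "integrable M (\<lambda>\<omega>. inner (Z i \<omega>) (Z j \<omega>))" for i j
    by (rule integrable_inner_of_square[OF meas meas sq sq])
  show "integrable M (\<lambda>\<omega>. (norm (\<Sum>i\<in>I. Z i \<omega>))\<^sup>2)"
    unfolding expand by (intro Bochner_Integration.integrable_sum int)
  have "(\<integral>\<omega>. (norm (\<Sum>i\<in>I. Z i \<omega>))\<^sup>2 \<partial>M) = (\<Sum>i\<in>I. \<Sum>j\<in>I. \<integral>\<omega>. inner (Z i \<omega>) (Z j \<omega>) \<partial>M)"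
    unfolding expand by (simp add: Bochner_Integration.integral_sum int)
  also have "\<dots> = (\<Sum>i\<in>I. \<Sum>j\<in>I. if i = j then \<integral>\<omega>. (norm (Z i \<omega>))\<^sup>2 \<partial>M else 0)"
    by (intro sum.cong refl) (simp add: orth power2_norm_eq_inner)
  also have "\<dots> = (\<Sum>i\<in>I. \<integral>\<omega>. (norm (Z i \<omega>))\<^sup>2 \<partial>M)"
    using \<open>finite I\<close> by simp
  finally show "(\<integral>\<omega>. (norm (\<Sum>i\<in>I. Z i \<omega>))\<^sup>2 \<partial>M) = (\<Sum>i\<in>I. \<integral>\<omega>. (norm (Z i \<omega>))\<^sup>2 \<partial>M)" .
qed

text \<open>The Rademacher--Menshov maximal inequality: for orthogonal summands, passing from the full sum to
  the maximum of the partial sums costs, in mean square, a squared logarithm of the number of terms.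
  Orthogonality turns the squared norm of a dyadic block into the sum of the second moments over it.
  The majorant has \<open>k + 1\<close> groups of squares: the single terms at the bottom of the recursion, and the
  blocks of each length \<open>2\<^sup>j\<close> with \<open>j < k\<close>. Within a group the blocks are disjoint, and the weights
  telescope to at most \<open>k + 1\<close>.\<close>
lemma
  fixes Z :: "nat \<Rightarrow> 'a \<Rightarrow> 'b::{real_inner, second_countable_topology}"
  assumes meas: "\<And>i. Z i \<in> borel_measurable M"
    and sq: "\<And>i. integrable M (\<lambda>\<omega>. (norm (Z i \<omega>))\<^sup>2)"
    and orth: "\<And>i j. i \<noteq> j \<Longrightarrow> (\<integral>\<omega>. inner (Z i \<omega>) (Z j \<omega>) \<partial>M) = 0"
  shows integrable_dyadic_bound: "integrable M (\<lambda>\<omega>. dyadic_bound (\<lambda>i. Z i \<omega>) k a)"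
    and integral_dyadic_bound_le:
      "(\<integral>\<omega>. dyadic_bound (\<lambda>i. Z i \<omega>) k a \<partial>M)
        \<le> (real k + 1)\<^sup>2 * (\<Sum>i=a..<a + 2 ^ k. \<integral>\<omega>. (norm (Z i \<omega>))\<^sup>2 \<partial>M)"
proof -
  note ints = integrable_norm_sum_square[OF meas sq orth]
  have int: "integrable M (\<lambda>\<omega>. dyadic_bound (\<lambda>i. Z i \<omega>) k a)" for k a
  proof (induction k arbitrary: a)
    case (Suc k)
    show ?case
      unfolding dyadic_bound.simps
      by (intro Bochner_Integration.integrable_add integrable_mult_right Suc.IH ints) auto
  qed (simp add: sq)
  thus "integrable M (\<lambda>\<omega>. dyadic_bound (\<lambda>i. Z i \<omega>) k a)" .
  show "(\<integral>\<omega>. dyadic_bound (\<lambda>i. Z i \<omega>) k a \<partial>M)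
        \<le> (real k + 1)\<^sup>2 * (\<Sum>i=a..<a + 2 ^ k. \<integral>\<omega>. (norm (Z i \<omega>))\<^sup>2 \<partial>M)"
  proof (induction k arbitrary: a)
    case (Suc k)
    define \<sigma> where "\<sigma> i = (\<integral>\<omega>. (norm (Z i \<omega>))\<^sup>2 \<partial>M)" for i
    define s t where "s = sum \<sigma> {a..<a + 2 ^ k}" and "t = sum \<sigma> {a + 2 ^ k..<a + 2 ^ k + 2 ^ k}"
    have st: "0 \<le> s" "0 \<le> t" unfolding s_def t_def \<sigma>_def by (auto intro!: sum_nonneg)
    have "(\<integral>\<omega>. dyadic_bound (\<lambda>i. Z i \<omega>) (Suc k) a \<partial>M)
        = (\<integral>\<omega>. dyadic_bound (\<lambda>i. Z i \<omega>) k a \<partial>M)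
          + (real k + 2) * (\<integral>\<omega>. (norm (\<Sum>i=a..<a + 2 ^ k. Z i \<omega>))\<^sup>2 \<partial>M)
          + (real k + 2) / (real k + 1) * (\<integral>\<omega>. dyadic_bound (\<lambda>i. Z i \<omega>) k (a + 2 ^ k) \<partial>M)"
      unfolding dyadic_bound.simps
      by (subst Bochner_Integration.integral_add Bochner_Integration.integral_mult_right,
          intro Bochner_Integration.integrable_add integrable_mult_right int ints,
          simp_all del: times_divide_eq_left add: int ints)+
    also have "\<dots> \<le> (real k + 1)\<^sup>2 * s + (real k + 2) * s
        + (real k + 2) / (real k + 1) * ((real k + 1)\<^sup>2 * t)"
      using Suc.IH[of a] Suc.IH[of "a + 2 ^ k"]
      by (intro add_mono mult_left_mono)
         (auto simp: s_def t_def \<sigma>_def integral_norm_orthogonal_sum[OF meas sq orth])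
    also have "\<dots> = ((real k + 1)\<^sup>2 + (real k + 2)) * s + (real k + 2) * (real k + 1) * t"
      by (simp add: field_simps power2_eq_square)
    also have "\<dots> \<le> (real k + 2)\<^sup>2 * s + (real k + 2)\<^sup>2 * t"
      using st by (intro add_mono mult_right_mono) (auto simp: power2_eq_square algebra_simps)
    also have "\<dots> = (real (Suc k) + 1)\<^sup>2 * (s + t)" by (simp add: algebra_simps)
    also have "s + t = sum \<sigma> {a..<a + 2 ^ Suc k}"
      unfolding s_def t_def by (subst sum.atLeastLessThan_concat) (auto simp: add.assoc mult_2)
    finally show ?case by (simp add: \<sigma>_def)
  qed simp
qed

text \<open>By independence the joint law is a product measure, and by Fubini's theorem the expectation is an
  iterated integral whose inner integral \<open>\<integral>\<langle>x, y\<rangle> dP\<^sub>V(y) = \<langle>x, E V\<rangle>\<close> vanishes.\<close>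
lemma (in prob_space) expectation_inner_indep_centered:
  fixes U V :: "'a \<Rightarrow> 'b::{real_inner, banach, second_countable_topology}"
  assumes ind: "indep_var borel U borel V"
    and U: "integrable M (\<lambda>\<omega>. (norm (U \<omega>))\<^sup>2)"
    and V: "integrable M (\<lambda>\<omega>. (norm (V \<omega>))\<^sup>2)" "expectation V = 0"
  shows "expectation (\<lambda>\<omega>. inner (U \<omega>) (V \<omega>)) = 0"
proof -
  note eq = ind[unfolded indep_var_distribution_eq]
  have [measurable]: "U \<in> borel_measurable M" "V \<in> borel_measurable M" using eq by auto
  interpret DU: prob_space "distr M borel U" by (rule prob_space_distr) simp
  interpret DV: prob_space "distr M borel V" by (rule prob_space_distr) simp
  interpret pair_sigma_finite "distr M borel U" "distr M borel V" ..
  have int: "integrable M (\<lambda>\<omega>. inner (U \<omega>) (V \<omega>))"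
    by (rule integrable_inner_of_square) (use U V in auto)
  have Vi: "integrable M V"
  proof (rule Bochner_Integration.integrable_bound)
    show "integrable M (\<lambda>\<omega>. 1 + (norm (V \<omega>))\<^sup>2)" using V by simp
    have le: "x \<le> 1 + x\<^sup>2" for x :: real
    proof -
      have "0 \<le> (x - 1 / 2)\<^sup>2" by simp
      also have "\<dots> = x\<^sup>2 - x + 1 / 4" by (simp add: power2_eq_square algebra_simps)
      finally show ?thesis by linarith
    qed
    thus "AE \<omega> in M. norm (V \<omega>) \<le> norm (1 + (norm (V \<omega>))\<^sup>2)" by (intro AE_I2) simp
  qed simp
  have zero: "(\<integral>y. inner x y \<partial>distr M borel V) = 0" for x
  proof -
    have "(\<integral>y. inner x y \<partial>distr M borel V) = expectation (\<lambda>\<omega>. inner x (V \<omega>))"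
      by (rule integral_distr) auto
    also have "\<dots> = inner x (expectation V)" using Vi by (intro integral_inner_right) simp
    finally show ?thesis by (simp add: V)
  qed
  have "expectation (\<lambda>\<omega>. inner (U \<omega>) (V \<omega>))
      = (\<integral>z. inner (fst z) (snd z) \<partial>distr M (borel \<Otimes>\<^sub>M borel) (\<lambda>\<omega>. (U \<omega>, V \<omega>)))"
    by (subst integral_distr) auto
  also have "\<dots> = (\<integral>z. inner (fst z) (snd z) \<partial>(distr M borel U \<Otimes>\<^sub>M distr M borel V))"
    using eq by simp
  also have "\<dots> = (\<integral>x. (\<integral>y. inner x y \<partial>distr M borel V) \<partial>distr M borel U)"
  proof -
    have "integrable (distr M (borel \<Otimes>\<^sub>M borel) (\<lambda>\<omega>. (U \<omega>, V \<omega>))) (\<lambda>z. inner (fst z) (snd z))"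
      using int by (subst integrable_distr_eq) auto
    hence "integrable (distr M borel U \<Otimes>\<^sub>M distr M borel V) (\<lambda>z. inner (fst z) (snd z))"
      using eq by simp
    from integral_fst'[OF this] show ?thesis by simp
  qed
  finally show ?thesis by (simp add: zero)
qed

section \<open>Truncation of identically distributed summands\<close>

lemma (in prob_space)
  fixes V W :: "'a \<Rightarrow> 'b::topological_space"
    and g :: "'b \<Rightarrow> 'c::{banach, second_countable_topology}"
  assumes "random_variable borel V" "random_variable borel W"
    and "distr M borel V = distr M borel W"
  shows integrable_same_law:
      "g \<in> borel_measurable borel \<Longrightarrow> integrable M (\<lambda>\<omega>. g (V \<omega>)) = integrable M (\<lambda>\<omega>. g (W \<omega>))"
    and expectation_same_law:
      "g \<in> borel_measurable borel \<Longrightarrow> expectation (\<lambda>\<omega>. g (V \<omega>)) = expectation (\<lambda>\<omega>. g (W \<omega>))"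
  using assms
  by (simp_all flip: integrable_distr_eq[of V M borel] integrable_distr_eq[of W M borel]
        integral_distr[of V M borel] integral_distr[of W M borel])

text \<open>Large vectors go to \<open>0\<close> and not to the sphere of radius \<open>\<tau>\<close>, so that \<open>truncate \<tau> y - y\<close> is either
  \<open>0\<close> or \<open>-y\<close>.\<close>
definition truncate :: "real \<Rightarrow> 'b::real_normed_vector \<Rightarrow> 'b" where
  "truncate \<tau> y = (if norm y \<le> \<tau> then y else 0)"

lemma measurable_truncate [measurable]:
  "(truncate \<tau> :: 'b::{real_normed_vector, second_countable_topology} \<Rightarrow> 'b) \<in> borel_measurable borel"
  unfolding truncate_def by measurable

text \<open>The two bounds below trade powers: where the norm is at most \<open>\<tau>\<close> a surplus of \<open>2 - p\<close> powers is
  bounded by \<open>\<tau> powr (2 - p)\<close>, and where it exceeds \<open>\<tau>\<close> the missing \<open>p - 1\<close> powers are supplied at the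
  price \<open>\<tau> powr (1 - p)\<close>.\<close>
lemma norm_truncate_square_le:
  assumes "0 < \<tau>" "p \<le> 2"
  shows "(norm (truncate \<tau> y))\<^sup>2 \<le> \<tau> powr (2 - p) * norm y powr p"
proof (cases "norm y \<le> \<tau> \<and> y \<noteq> 0")
  case True
  have "(norm y)\<^sup>2 = norm y powr (2 - p) * norm y powr p"
    using True by (simp flip: powr_add)
  also have "\<dots> \<le> \<tau> powr (2 - p) * norm y powr p"
    using True assms by (intro mult_right_mono powr_mono2) auto
  finally show ?thesis using True by (simp add: truncate_def)
qed (auto simp: truncate_def)

lemma norm_diff_truncate_le:
  assumes "0 < \<tau>" "1 \<le> p"
  shows "norm (truncate \<tau> y - y) \<le> \<tau> powr (1 - p) * norm y powr p"
proof (cases "norm y \<le> \<tau>")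
  case False
  hence "norm y = norm y powr (1 - p) * norm y powr p"
    using assms by (simp flip: powr_add)
  also have "\<dots> \<le> \<tau> powr (1 - p) * norm y powr p"
    using False assms by (intro mult_right_mono powr_mono2') auto
  finally show ?thesis using False by (simp add: truncate_def)
qed (auto simp: truncate_def)

lemma integrable_of_integrable_powr:
  fixes W :: "'a \<Rightarrow> 'b::{banach, second_countable_topology}"
  assumes "finite_measure M" "W \<in> borel_measurable M" "1 \<le> p"
    and "integrable M (\<lambda>\<omega>. norm (W \<omega>) powr p)"
  shows "integrable M W"
proof (rule Bochner_Integration.integrable_bound)
  interpret finite_measure M by fact
  show "integrable M (\<lambda>\<omega>. 1 + norm (W \<omega>) powr p)" using assms by simp
  have "x \<le> 1 + x powr p" if "0 \<le> x" for x
  proof (cases "x \<le> 1")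
    case False
    hence "x powr 1 \<le> x powr p" using assms by (intro powr_mono) auto
    thus ?thesis using False by simp
  qed (simp add: add_increasing2)
  thus "AE \<omega> in M. norm (W \<omega>) \<le> norm (1 + norm (W \<omega>) powr p)" by (intro AE_I2) auto
qed fact

text \<open>The probability that some partial sum among the first \<open>2\<^sup>k\<close> is large, for a truncation level \<open>\<tau>\<close> at
  which truncation bias is harmless: the condition \<open>2\<^sup>k \<le> \<tau>\<^sup>p\<close> makes the accumulated bias
  \<open>2\<^sup>k \<tau>\<^bsup>1 - p\<^esup> K\<close> at most \<open>K \<tau>\<close>. A deviation above \<open>(1 + K) \<tau>\<close> then needs a summand exceeding \<open>\<tau>\<close>
  (Markov's inequality for the moment of order \<open>p\<close>) or a partial sum of the centered truncated
  summands exceeding \<open>\<tau>\<close> (Markov's inequality for the dyadic majorant). Both have probability of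
  order \<open>2\<^sup>k \<tau>\<^bsup>-p\<^esup>\<close>, up to the logarithmic factor of the maximal inequality.\<close>
lemma (in prob_space) prob_partial_sum_deviation_le:
  fixes Y :: "nat \<Rightarrow> 'a \<Rightarrow> 'b::{real_inner, banach, second_countable_topology}"
  assumes Y: "\<And>i. random_variable borel (Y i)"
    and W: "random_variable borel W"
    and ident: "\<And>i. distr M borel (Y i) = distr M borel W"
    and indep: "\<And>i j. i \<noteq> j \<Longrightarrow> indep_var borel (Y i) borel (Y j)"
    and p: "1 \<le> p" "p \<le> 2"
    and int: "integrable M (\<lambda>\<omega>. norm (W \<omega>) powr p)"
    and K: "K = expectation (\<lambda>\<omega>. norm (W \<omega>) powr p)"
    and \<tau>: "0 < \<tau>" "2 ^ k \<le> \<tau> powr p"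
  shows "prob {\<omega> \<in> space M. \<exists>n\<le>2 ^ k. (1 + K) * \<tau> < norm (\<Sum>i<n. Y i \<omega> - expectation W)}
    \<le> ((real k + 1)\<^sup>2 + 1) * K * (2 ^ k * \<tau> powr - p)"
proof -
  note Y[measurable] W[measurable]
  note Wi = integrable_of_integrable_powr[OF finite_measure_axioms W p(1) int]
  have K0: "0 \<le> K" unfolding K by simp
  define c where "c = expectation (\<lambda>\<omega>. truncate \<tau> (W \<omega>))"
  define Z where "Z i \<omega> = truncate \<tau> (Y i \<omega>) - c" for i \<omega>
  have Z[measurable]: "random_variable borel (Z i)" for i unfolding Z_def by measurable
  have trunc: "integrable M (\<lambda>\<omega>. truncate \<tau> (V \<omega>))" if "random_variable borel V" for V :: "'a \<Rightarrow> 'b"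
    using that by (intro integrable_const_bound[where B = \<tau>] AE_I2)
      (use \<tau>(1) in \<open>auto simp: truncate_def\<close>)
  have trunc2: "integrable M (\<lambda>\<omega>. (norm (truncate \<tau> (W \<omega>)))\<^sup>2)"
    by (intro integrable_const_bound[where B = "\<tau>\<^sup>2"] AE_I2)
      (use \<tau>(1) in \<open>auto simp: truncate_def\<close>)
  have Yc: "expectation (\<lambda>\<omega>. truncate \<tau> (Y i \<omega>)) = c" for i
    unfolding c_def by (rule expectation_same_law[OF Y W ident]) measurable
  have bias: "norm (c - expectation W) \<le> \<tau> powr (1 - p) * K"
  proof -
    have "c - expectation W = expectation (\<lambda>\<omega>. truncate \<tau> (W \<omega>) - W \<omega>)"
      unfolding c_def by (simp add: trunc Wi)
    also have "norm \<dots> \<le> expectation (\<lambda>\<omega>. norm (truncate \<tau> (W \<omega>) - W \<omega>))"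
      by (rule integral_norm_bound)
    also have "\<dots> \<le> expectation (\<lambda>\<omega>. \<tau> powr (1 - p) * norm (W \<omega>) powr p)"
      using norm_diff_truncate_le[OF \<tau>(1) p(1)]
      by (intro integral_mono) (simp_all add: trunc Wi int)
    finally show ?thesis by (simp add: K)
  qed
  have Zsq: "integrable M (\<lambda>\<omega>. (norm (Z i \<omega>))\<^sup>2)"
    "expectation (\<lambda>\<omega>. (norm (Z i \<omega>))\<^sup>2) \<le> \<tau> powr (2 - p) * K" for i
  proof -
    have eq: "(norm (truncate \<tau> y - c))\<^sup>2
        = (norm (truncate \<tau> y))\<^sup>2 - 2 * inner c (truncate \<tau> y) + (norm c)\<^sup>2" for y :: 'b
      by (simp add: power2_norm_eq_inner inner_diff inner_commute)
    have iW: "integrable M (\<lambda>\<omega>. (norm (truncate \<tau> (W \<omega>) - c))\<^sup>2)"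
      unfolding eq by (simp add: trunc trunc2)
    show "integrable M (\<lambda>\<omega>. (norm (Z i \<omega>))\<^sup>2)"
      unfolding Z_def using iW
      by (subst integrable_same_law[OF Y W ident, where g = "\<lambda>y. (norm (truncate \<tau> y - c))\<^sup>2"]) auto
    have "expectation (\<lambda>\<omega>. (norm (Z i \<omega>))\<^sup>2) = expectation (\<lambda>\<omega>. (norm (truncate \<tau> (W \<omega>) - c))\<^sup>2)"
      unfolding Z_def
      by (rule expectation_same_law[OF Y W ident, where g = "\<lambda>y. (norm (truncate \<tau> y - c))\<^sup>2"]) measurable
    also have "\<dots> = expectation (\<lambda>\<omega>. (norm (truncate \<tau> (W \<omega>)))\<^sup>2) - (norm c)\<^sup>2"
    proof -
      have "expectation (\<lambda>\<omega>. inner c (truncate \<tau> (W \<omega>))) = (norm c)\<^sup>2"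
        by (simp add: trunc power2_norm_eq_inner flip: c_def)
      thus ?thesis unfolding eq by (simp add: trunc trunc2 prob_space)
    qed
    also have "\<dots> \<le> expectation (\<lambda>\<omega>. (norm (truncate \<tau> (W \<omega>)))\<^sup>2)" by simp
    also have "\<dots> \<le> expectation (\<lambda>\<omega>. \<tau> powr (2 - p) * norm (W \<omega>) powr p)"
      using norm_truncate_square_le[OF \<tau>(1) p(2)]
      by (intro integral_mono) (simp_all add: trunc2 int)
    finally show "expectation (\<lambda>\<omega>. (norm (Z i \<omega>))\<^sup>2) \<le> \<tau> powr (2 - p) * K" by (simp add: K)
  qed
  have orth: "expectation (\<lambda>\<omega>. inner (Z i \<omega>) (Z j \<omega>)) = 0" if "i \<noteq> j" for i j
  proof (rule expectation_inner_indep_centered)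
    have "indep_var borel ((\<lambda>y. truncate \<tau> y - c) \<circ> Y i) borel ((\<lambda>y. truncate \<tau> y - c) \<circ> Y j)"
      by (rule indep_var_compose[OF indep[OF that]]) measurable
    thus "indep_var borel (Z i) borel (Z j)" by (simp add: Z_def[abs_def] comp_def)
    show "expectation (Z j) = 0" unfolding Z_def by (simp add: trunc Yc prob_space)
  qed (rule Zsq)+

  define G where "G \<omega> = dyadic_bound (\<lambda>i. Z i \<omega>) k 0" for \<omega>
  have G_int: "integrable M G"
    unfolding G_def by (rule integrable_dyadic_bound[OF Z Zsq(1) orth])
  have [measurable]: "G \<in> borel_measurable M" using G_int by auto
  have "expectation G \<le> (real k + 1)\<^sup>2 * (\<Sum>i=0..<0 + 2 ^ k. expectation (\<lambda>\<omega>. (norm (Z i \<omega>))\<^sup>2))"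
    unfolding G_def by (rule integral_dyadic_bound_le[OF Z Zsq(1) orth])
  also have "\<dots> \<le> (real k + 1)\<^sup>2 * (\<Sum>i=0..<0 + (2::nat) ^ k. \<tau> powr (2 - p) * K)"
    by (intro mult_left_mono sum_mono Zsq) simp
  finally have EG: "expectation G \<le> (real k + 1)\<^sup>2 * (2 ^ k * (\<tau> powr (2 - p) * K))" by simp
  define A where "A i = {\<omega> \<in> space M. \<tau> powr p \<le> norm (Y i \<omega>) powr p}" for i
  define B where "B = {\<omega> \<in> space M. \<tau>\<^sup>2 \<le> G \<omega>}"
  have [measurable]: "A i \<in> events" "B \<in> events" for i unfolding A_def B_def by measurable
  have PA: "prob (A i) \<le> K * \<tau> powr - p" for i
  proof -
    have "integrable M (\<lambda>\<omega>. norm (Y i \<omega>) powr p)"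
      using int by (subst integrable_same_law[OF Y W ident, where g = "\<lambda>y. norm y powr p"]) auto
    hence "prob (A i) \<le> expectation (\<lambda>\<omega>. norm (Y i \<omega>) powr p) / \<tau> powr p"
      unfolding A_def by (rule integral_Markov_inequality_measure[where A = "{}"]) (use \<tau> in auto)
    also have "expectation (\<lambda>\<omega>. norm (Y i \<omega>) powr p) = K"
      unfolding K by (rule expectation_same_law[OF Y W ident, where g = "\<lambda>y. norm y powr p"]) measurable
    finally show ?thesis by (simp add: powr_minus_divide)
  qed
  have PB: "prob B \<le> (real k + 1)\<^sup>2 * K * (2 ^ k * \<tau> powr - p)"
  proof -
    have "prob B \<le> expectation G / \<tau>\<^sup>2"
      unfolding B_def using G_int
      by (rule integral_Markov_inequality_measure[where A = "{}"]) (use \<tau> in \<open>auto simp: G_def dyadic_bound_nonneg\<close>)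
    also have "\<dots> \<le> (real k + 1)\<^sup>2 * (2 ^ k * (\<tau> powr (2 - p) * K)) / \<tau>\<^sup>2"
      using EG by (rule divide_right_mono) simp
    also have "\<tau> powr (2 - p) = \<tau>\<^sup>2 * \<tau> powr - p"
      using \<tau>(1) by (simp flip: powr_add powr_numeral)
    finally show ?thesis using \<tau>(1) by (simp add: field_simps)
  qed
  have "{\<omega> \<in> space M. \<exists>n\<le>2 ^ k. (1 + K) * \<tau> < norm (\<Sum>i<n. Y i \<omega> - expectation W)}
      \<subseteq> (\<Union>i<2 ^ k. A i) \<union> B" (is "?bad \<subseteq> _")
  proof (rule subsetI, rule ccontr)
    fix \<omega> assume \<omega>: "\<omega> \<in> ?bad" and "\<omega> \<notin> (\<Union>i<2 ^ k. A i) \<union> B"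
    then obtain n where n: "n \<le> 2 ^ k" "(1 + K) * \<tau> < norm (\<Sum>i<n. Y i \<omega> - expectation W)"
      and nA: "\<And>i. i < 2 ^ k \<Longrightarrow> norm (Y i \<omega>) powr p < \<tau> powr p" and nB: "G \<omega> < \<tau>\<^sup>2"
      by (auto simp: A_def B_def not_le)
    have "norm (Y i \<omega>) \<le> \<tau>" if "i < 2 ^ k" for i
      using nA[OF that] \<tau>(1) p powr_mono2[of p \<tau> "norm (Y i \<omega>)"] by (auto simp: not_less[symmetric])
    hence "Y i \<omega> - expectation W = Z i \<omega> + (c - expectation W)" if "i < n" for i
      using that n(1) by (simp add: Z_def truncate_def)
    hence "(\<Sum>i<n. Y i \<omega> - expectation W) = (\<Sum>i<n. Z i \<omega> + (c - expectation W))"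
      by (intro sum.cong) auto
    also have "\<dots> = (\<Sum>i<n. Z i \<omega>) + real n *\<^sub>R (c - expectation W)"
      by (simp only: sum.distrib sum_constant_scaleR card_lessThan)
    finally have "norm (\<Sum>i<n. Y i \<omega> - expectation W)
        \<le> norm (\<Sum>i<n. Z i \<omega>) + real n * norm (c - expectation W)"
      using norm_triangle_ineq[of "\<Sum>i<n. Z i \<omega>" "real n *\<^sub>R (c - expectation W)"] by simp
    also have "norm (\<Sum>i<n. Z i \<omega>) \<le> \<tau>"
    proof (rule power2_le_imp_le)
      show "(norm (\<Sum>i<n. Z i \<omega>))\<^sup>2 \<le> \<tau>\<^sup>2"
        using norm_partial_sum_le_dyadic_bound[OF n(1), of "\<lambda>i. Z i \<omega>" 0] nB
        by (simp add: G_def atLeast0LessThan)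
    qed (use \<tau>(1) in simp)
    also have "real n * norm (c - expectation W) \<le> \<tau> powr p * (\<tau> powr (1 - p) * K)"
    proof (rule mult_mono[OF _ bias])
      have "real n \<le> 2 ^ k" using n(1) by simp
      thus "real n \<le> \<tau> powr p" using \<tau>(2) by (rule order_trans)
    qed simp_all
    also have "\<dots> = K * \<tau>"
      using \<tau>(1) by (simp flip: powr_add mult.assoc)
    finally show False using n(2) by (simp add: algebra_simps)
  qed
  hence "prob ?bad \<le> prob ((\<Union>i<2 ^ k. A i) \<union> B)"
    by (intro finite_measure_mono) auto
  also have "\<dots> \<le> prob (\<Union>i<2 ^ k. A i) + prob B"
    by (intro measure_Un_le) auto
  also have "prob (\<Union>i<2 ^ k. A i) \<le> (\<Sum>i<2 ^ k. prob (A i))"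
    by (intro measure_UNION_le) auto
  also have "\<dots> \<le> (\<Sum>i<(2::nat) ^ k. K * \<tau> powr - p)"
    by (intro sum_mono PA)
  finally show ?thesis using PB by (simp add: algebra_simps)
qed
section \<open>The strong law with a rate in Hilbert space\<close>

text \<open>The strict inequality \<open>\<gamma> < p\<close> leaves room for an exponent \<open>q\<close> between them. Truncating the first
  \<open>2\<^sup>k\<close> summands at level \<open>2\<^bsup>k / q\<^esup>\<close> gives exceptional probabilities of order \<open>k\<^sup>2 \<rho>\<^sup>k\<close> with
  \<open>\<rho> = 2\<^bsup>1 - p / q\<^esup> < 1\<close>, because \<open>q < p\<close>; these are summable, so by Borel--Cantelli the partial sums up
  to \<open>N\<close> are almost surely \<open>O(N\<^bsup>1 / q\<^esup>)\<close>, which is \<open>o(N\<^bsup>1 / \<gamma>\<^esup>)\<close> because \<open>\<gamma> < q\<close>.\<close>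
theorem (in prob_space) marcinkiewicz_zygmund_strong_law:
  fixes Y :: "nat \<Rightarrow> 'a \<Rightarrow> 'b::{real_inner, banach, second_countable_topology}"
  assumes Y: "\<And>i. random_variable borel (Y i)"
    and W: "random_variable borel W"
    and ident: "\<And>i. distr M borel (Y i) = distr M borel W"
    and indep: "\<And>i j. i \<noteq> j \<Longrightarrow> indep_var borel (Y i) borel (Y j)"
    and p: "1 \<le> \<gamma>" "\<gamma> < p" "p \<le> 2"
    and int: "integrable M (\<lambda>\<omega>. norm (W \<omega>) powr p)"
  shows "AE \<omega> in M. (\<lambda>N. real N powr (- 1 / \<gamma>) * norm (\<Sum>i<N. Y i \<omega> - expectation W)) \<longlonglongrightarrow> 0"
proof -
  define K where "K = expectation (\<lambda>\<omega>. norm (W \<omega>) powr p)"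
  have K0: "0 \<le> K" unfolding K_def by simp
  \<comment> \<open>Any exponent strictly between \<open>\<gamma>\<close> and \<open>p\<close> serves.\<close>
  define q where "q = (\<gamma> + p) / 2"
  have q: "\<gamma> < q" "q < p" "1 < q" using p by (auto simp: q_def)
  define \<tau> where "\<tau> k = (2 powr (1 / q)) ^ k" for k :: nat
  define \<rho> where "\<rho> = 2 powr (1 - p / q)"
  have \<rho>: "0 < \<rho>" "\<rho> < 1"
    using q powr_less_mono[of "1 - p / q" 0 2] by (simp_all add: \<rho>_def)
  have \<tau>: "0 < \<tau> k" "2 ^ k \<le> \<tau> k powr p" "2 ^ k * \<tau> k powr - p = \<rho> ^ k" for k
  proof -
    have \<tau>p: "\<tau> k = 2 powr (real k / q)" by (simp add: \<tau>_def powr_powr flip: powr_realpow)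
    show "0 < \<tau> k" by (simp add: \<tau>_def)
    have "(2::real) powr real k \<le> 2 powr (real k / q * p)"
      using q by (intro powr_mono) (auto simp: field_simps intro: mult_right_mono)
    thus "2 ^ k \<le> \<tau> k powr p" by (simp add: \<tau>p powr_powr powr_realpow)
    have "2 ^ k * \<tau> k powr - p = 2 powr (real k + real k / q * - p)"
      unfolding \<tau>p powr_powr powr_add by (simp add: powr_realpow)
    also have "real k + real k / q * - p = (1 - p / q) * real k" by (simp add: algebra_simps)
    also have "2 powr \<dots> = \<rho> ^ k" by (simp add: \<rho>_def powr_powr flip: powr_realpow)
    finally show "2 ^ k * \<tau> k powr - p = \<rho> ^ k" .
  qed
  define S where "S N \<omega> = (\<Sum>i<N. Y i \<omega> - expectation W)" for N \<omega>
  note Y[measurable]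
  have [measurable]: "random_variable borel (S N)" for N unfolding S_def by measurable
  define E where "E k = {\<omega> \<in> space M. \<exists>n\<le>2 ^ k. (1 + K) * \<tau> k < norm (S n \<omega>)}" for k
  have [measurable]: "E k \<in> events" for k unfolding E_def by measurable
  have PE: "prob (E k) \<le> ((real k + 1)\<^sup>2 + 1) * K * \<rho> ^ k" for k
    unfolding E_def S_def \<tau>(3)[symmetric]
    by (rule prob_partial_sum_deviation_le[OF Y W ident indep _ p(3) int K_def \<tau>(1,2)]) (use p in auto)
  have "summable (\<lambda>k. ((real k + 1)\<^sup>2 + 1) * \<rho> ^ k)"
  proof (rule summable_comparison_test_bigo)
    show "summable (\<lambda>k. norm (sqrt \<rho> ^ k))" using \<rho> by (simp add: summable_geometric)
    \<comment> \<open>One factor \<open>\<surd>\<rho>\<^sup>k\<close> absorbs the polynomial, the other one is summable.\<close>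
    have "(\<lambda>k. ((real k + 1)\<^sup>2 + 1) * (r ^ k * r ^ k)) \<in> O(\<lambda>k. r ^ k)" if "0 < r" "r < 1" for r :: real
      using that by real_asymp
    from this[of "sqrt \<rho>"] show "(\<lambda>k. ((real k + 1)\<^sup>2 + 1) * \<rho> ^ k) \<in> O(\<lambda>k. sqrt \<rho> ^ k)"
      using \<rho> by (simp flip: power_mult_distrib)
  qed
  from summable_mult[OF this, of K] have "summable (\<lambda>k. ((real k + 1)\<^sup>2 + 1) * K * \<rho> ^ k)"
    by (simp add: mult_ac)
  hence "summable (\<lambda>k. prob (E k))"
    by (rule summable_comparison_test'[where N = 0]) (use PE in simp)
  from borel_cantelli_AE1[OF _ _ this]
  have "AE \<omega> in M. eventually (\<lambda>k. \<omega> \<in> space M - E k) sequentially"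
    by (auto simp: emeasure_eq_measure)
  moreover have "(\<lambda>N. real N powr (- 1 / \<gamma>) * norm (S N \<omega>)) \<longlonglongrightarrow> 0"
    if ev: "eventually (\<lambda>k. \<omega> \<in> space M - E k) sequentially" for \<omega>
  proof -
    from ev obtain k0 where k0: "\<And>k. k0 \<le> k \<Longrightarrow> \<omega> \<in> space M - E k"
      by (auto simp: eventually_sequentially)
    have bound: "norm (real N powr (- 1 / \<gamma>) * norm (S N \<omega>))
        \<le> 2 powr (1 / q) * (1 + K) * real N powr (1 / q - 1 / \<gamma>)" if N: "2 ^ k0 \<le> N" for N
    proof -
      \<comment> \<open>The least dyadic range \<open>{..2\<^sup>k}\<close> with \<open>N < 2\<^sup>k\<close>; it satisfies \<open>2\<^sup>k \<le> 2 N\<close>, which costs the factor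
        \<open>2\<^bsup>1 / q\<^esup>\<close>.\<close>
      define k where "k = Suc (floor_log N)"
      have "0 < N" using N by (auto intro: Nat.gr0I)
      hence kN: "2 ^ floor_log N \<le> N" "N < 2 ^ k"
        using floor_log_exp2_gt[of N] by (simp_all add: k_def floor_log_exp2_le)
      have "(2::nat) ^ k0 < 2 ^ k" using N kN(2) by linarith
      hence "k0 \<le> k" by simp
      hence "norm (S N \<omega>) \<le> (1 + K) * \<tau> k" using k0[of k] kN(2) by (auto simp: E_def not_less)
      moreover have "\<tau> k \<le> 2 powr (1 / q) * real N powr (1 / q)"
      proof -
        have "real (2 ^ floor_log N) \<le> real N" using kN(1) by (simp only: of_nat_le_iff)
        hence "(2 ^ floor_log N) powr (1 / q) \<le> real N powr (1 / q)"
          using q by (intro powr_mono2) auto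
        moreover have "(2 ^ floor_log N) powr (1 / q) = (2 powr (1 / q)) ^ floor_log N"
          by (simp add: powr_powr mult.commute flip: powr_realpow)
        ultimately show ?thesis by (simp add: \<tau>_def k_def)
      qed
      ultimately have "norm (S N \<omega>) \<le> (1 + K) * (2 powr (1 / q) * real N powr (1 / q))"
        using K0 by (meson add_nonneg_nonneg mult_left_mono order_trans zero_le_one)
      hence "real N powr (- 1 / \<gamma>) * norm (S N \<omega>)
          \<le> real N powr (- 1 / \<gamma>) * ((1 + K) * (2 powr (1 / q) * real N powr (1 / q)))"
        by (rule mult_left_mono) simp
      also have "\<dots> = 2 powr (1 / q) * (1 + K) * real N powr (1 / q - 1 / \<gamma>)"
        by (simp add: powr_diff powr_minus_divide)
      finally show ?thesis by simp
    qed
    have "1 / q - 1 / \<gamma> < 0" using q p by (simp add: field_simps)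
    hence "(\<lambda>N. 2 powr (1 / q) * (1 + K) * real N powr (1 / q - 1 / \<gamma>)) \<longlonglongrightarrow> 0"
      by (intro tendsto_mult_right_zero tendsto_neg_powr filterlim_real_sequentially)
    moreover have "\<forall>\<^sub>F N in sequentially. norm (real N powr (- 1 / \<gamma>) * norm (S N \<omega>))
        \<le> 2 powr (1 / q) * (1 + K) * real N powr (1 / q - 1 / \<gamma>)"
      using eventually_ge_at_top[of "2 ^ k0"] by eventually_elim (rule bound)
    ultimately show ?thesis by (rule Lim_null_comparison[rotated])
  qed
  ultimately show ?thesis unfolding S_def by (rule eventually_mono)
qed

section \<open>Moments of regularly varying elements\<close>

text \<open>Decompose the range of \<open>R\<close> into the shells \<open>2\<^sup>k u < R \<le> 2\<^bsup>k + 1\<^esup> u\<close>. Iterating the decay shows that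
  shell \<open>k\<close> has probability at most \<open>2\<^bsup>- \<beta> k\<^esup>\<close>, while \<open>R\<^sup>s\<close> is of order \<open>2\<^bsup>s k\<^esup>\<close> there, so that
  \<open>s < \<beta>\<close> gives a convergent geometric series.\<close>
lemma (in prob_space) integrable_powr_of_tail_decay:
  fixes R :: "'a \<Rightarrow> real"
  assumes R[measurable]: "random_variable borel R" and R0: "\<And>\<omega>. 0 \<le> R \<omega>"
    and s: "0 < s" "s < \<beta>" and u: "0 < u"
    and decay: "\<And>t. u \<le> t \<Longrightarrow> prob {\<omega> \<in> space M. 2 * t < R \<omega>} \<le> 2 powr - \<beta> * prob {\<omega> \<in> space M. t < R \<omega>}"
  shows "integrable M (\<lambda>\<omega>. R \<omega> powr s)"
proof (rule integrableI_bounded)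
  define F where "F k = {\<omega> \<in> space M. 2 ^ k * u < R \<omega>}" for k :: nat
  have [measurable]: "F k \<in> events" for k unfolding F_def by measurable
  have PF: "prob (F k) \<le> (2 powr - \<beta>) ^ k" for k
  proof (induction k)
    case (Suc k)
    have "1 * u \<le> 2 ^ k * u" using u by (intro mult_right_mono) auto
    hence "prob (F (Suc k)) \<le> 2 powr - \<beta> * prob (F k)"
      using decay[of "2 ^ k * u"] by (simp add: F_def mult.assoc)
    also have "\<dots> \<le> 2 powr - \<beta> * (2 powr - \<beta>) ^ k" by (intro mult_left_mono Suc.IH) simp
    finally show ?case by simp
  qed simp
  define h where "h k \<omega> = (2 ^ Suc k * u) powr s * indicator (F k) \<omega>" for k \<omega>
  have pointwise: "ennreal (R \<omega> powr s) \<le> ennreal (u powr s) + (\<Sum>k. ennreal (h k \<omega>))"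
    if "\<omega> \<in> space M" for \<omega>
  proof (cases "R \<omega> \<le> u")
    case True
    hence "R \<omega> powr s \<le> u powr s" using R0 s by (intro powr_mono2) auto
    hence "ennreal (R \<omega> powr s) \<le> ennreal (u powr s)" by (rule ennreal_leI)
    thus ?thesis by (simp add: add_increasing2)
  next
    case False
    obtain n :: nat where "R \<omega> / u < 2 ^ n" using real_arch_pow[of 2 "R \<omega> / u"] by auto
    hence ex: "R \<omega> \<le> 2 ^ n * u" using u by (simp add: field_simps)
    define m where "m = (LEAST n. R \<omega> \<le> 2 ^ n * u)"
    have m: "R \<omega> \<le> 2 ^ m * u" unfolding m_def using ex by (rule LeastI)
    hence "m \<noteq> 0" using False by (cases m) auto
    then obtain k where k: "m = Suc k" by (cases m) auto
    hence "\<not> R \<omega> \<le> 2 ^ k * u" using not_less_Least[of k "\<lambda>n. R \<omega> \<le> 2 ^ n * u"] by (simp add: m_def)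
    hence "\<omega> \<in> F k" using that by (simp add: F_def)
    have "R \<omega> powr s \<le> (2 ^ Suc k * u) powr s" using m k R0 s by (intro powr_mono2) auto
    hence "ennreal (R \<omega> powr s) \<le> ennreal (h k \<omega>)"
      using \<open>\<omega> \<in> F k\<close> by (intro ennreal_leI) (simp add: h_def)
    also have "\<dots> = (\<Sum>i\<in>{k}. ennreal (h i \<omega>))" by simp
    also have "\<dots> \<le> (\<Sum>i. ennreal (h i \<omega>))" by (rule sum_le_suminf) auto
    finally show ?thesis by (simp add: add_increasing)
  qed
  define r where "r = 2 powr (s - \<beta>)"
  have r: "0 < r" "r < 1" using s powr_less_mono[of "s - \<beta>" 0 2] by (simp_all add: r_def)
  have geo: "(2 ^ Suc k * u) powr s * (2 powr - \<beta>) ^ k = (2 * u) powr s * r ^ k" for k :: nat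
  proof -
    have "(2 ^ Suc k * u) powr s = (2 * u) powr s * (2 ^ k) powr s"
      using u by (simp add: powr_mult mult_ac)
    also have "(2 ^ k) powr s = (2 powr s) ^ k"
      by (simp add: powr_powr mult.commute flip: powr_realpow)
    finally show ?thesis
      by (simp add: r_def powr_diff powr_minus_divide power_divide power_mult_distrib)
  qed
  have "(\<integral>\<^sup>+\<omega>. ennreal (norm (R \<omega> powr s)) \<partial>M)
      \<le> (\<integral>\<^sup>+\<omega>. ennreal (u powr s) + (\<Sum>k. ennreal (h k \<omega>)) \<partial>M)"
    using pointwise by (intro nn_integral_mono) simp
  also have "\<dots> = ennreal (u powr s) + (\<Sum>k. \<integral>\<^sup>+\<omega>. ennreal (h k \<omega>) \<partial>M)"
    unfolding h_def by (simp add: nn_integral_add nn_integral_suminf emeasure_space_1)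
  also have "\<dots> \<le> ennreal (u powr s) + (\<Sum>k. ennreal ((2 * u) powr s * r ^ k))"
  proof (intro add_left_mono suminf_le)
    fix k
    have "(\<integral>\<^sup>+\<omega>. ennreal (h k \<omega>) \<partial>M) = ennreal ((2 ^ Suc k * u) powr s * prob (F k))"
    proof -
      have "ennreal (h k \<omega>) = ennreal ((2 ^ Suc k * u) powr s) * indicator (F k) \<omega>" for \<omega>
        by (simp add: h_def split: split_indicator)
      thus ?thesis by (simp add: nn_integral_cmult_indicator emeasure_eq_measure ennreal_mult)
    qed
    also have "\<dots> \<le> ennreal ((2 ^ Suc k * u) powr s * (2 powr - \<beta>) ^ k)"
      by (intro ennreal_leI mult_left_mono PF) simp
    finally show "(\<integral>\<^sup>+\<omega>. ennreal (h k \<omega>) \<partial>M) \<le> ennreal ((2 * u) powr s * r ^ k)"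
      by (simp only: geo)
  qed simp_all
  also have "\<dots> < \<infinity>"
    using r by (subst suminf_ennreal2) (auto intro!: summable_mult summable_geometric)
  finally show "(\<integral>\<^sup>+\<omega>. ennreal (norm (R \<omega> powr s)) \<partial>M) < \<infinity>" .
qed measurable

text \<open>For large \<open>u\<close> the ratio \<open>L (2 u) / L u\<close> is below \<open>2\<^bsup>\<alpha> - \<beta>\<^esup>\<close>, so doubling the threshold multiplies the tail probability by at most \<open>2\<^bsup>- \<beta>\<^esup>\<close> for any chosen \<open>\<beta> < \<alpha>\<close>.\<close>
lemma (in prob_space) regularly_varying_integrable_powr:
  assumes rv: "regularly_varying M X \<alpha>" and s: "0 < s" "s < \<alpha>"
  shows "integrable M (\<lambda>\<omega>. norm (X \<omega>) powr s)"
proof -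
  obtain L where L: "slowly_varying L"
    and tail: "\<And>u. 0 < u \<Longrightarrow> prob {\<omega> \<in> space M. u < norm (X \<omega>)} = u powr (- \<alpha>) * L u"
    and X[measurable]: "random_variable borel X"
    using rv by (auto simp: regularly_varying_def)
  define \<beta> where "\<beta> = (s + \<alpha>) / 2"
  have \<beta>: "s < \<beta>" "\<beta> < \<alpha>" using s by (auto simp: \<beta>_def)
  have "((\<lambda>u. L (2 * u) / L u) \<longlongrightarrow> 1) at_top" using L by (simp add: slowly_varying_def)
  moreover have "1 < 2 powr (\<alpha> - \<beta>)" using \<beta> by simp
  ultimately have "\<forall>\<^sub>F u in at_top. L (2 * u) / L u < 2 powr (\<alpha> - \<beta>)" "\<forall>\<^sub>F u in at_top. 0 < L (2 * u) / L u"
    by (auto intro: order_tendstoD(1)[of _ 1 _ 0] order_tendstoD(2)[of _ 1])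
  then obtain u0 where u0: "\<And>u. u0 \<le> u \<Longrightarrow> L (2 * u) / L u < 2 powr (\<alpha> - \<beta>)"
    "\<And>u. u0 \<le> u \<Longrightarrow> 0 < L (2 * u) / L u"
    unfolding eventually_at_top_linorder by (metis (no_types, opaque_lifting) linorder_le_cases order_trans)
  show ?thesis
  proof (rule integrable_powr_of_tail_decay[where \<beta> = \<beta> and u = "max 1 u0"])
    fix t assume t: "max 1 u0 \<le> t"
    hence t0: "0 < t" by simp
    \<comment> \<open>Slow variation says nothing about the sign of \<open>L\<close>; positivity comes from the tail formula and
      from the ratio being nonzero, since division by \<open>0\<close> yields \<open>0\<close>.\<close>
    have "0 \<le> t powr (- \<alpha>) * L t" using tail[OF t0] by (metis measure_nonneg)
    hence "0 \<le> L t" using t0 by (simp add: zero_le_mult_iff)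
    moreover have "L t \<noteq> 0" using u0(2)[of t] t by auto
    ultimately have Lt: "0 < L t" by simp
    hence "L (2 * t) \<le> 2 powr (\<alpha> - \<beta>) * L t" using u0(1)[of t] t by (simp add: field_simps)
    hence "(2 * t) powr (- \<alpha>) * L (2 * t) \<le> (2 * t) powr (- \<alpha>) * (2 powr (\<alpha> - \<beta>) * L t)"
      by (rule mult_left_mono) simp
    also have "\<dots> = 2 powr - \<beta> * (t powr (- \<alpha>) * L t)"
      using t0 by (simp add: powr_mult flip: powr_add)
    finally show "prob {\<omega> \<in> space M. 2 * t < norm (X \<omega>)}
        \<le> 2 powr - \<beta> * prob {\<omega> \<in> space M. t < norm (X \<omega>)}"
      using tail[of t] tail[of "2 * t"] t0 by simp
  qed (use s \<beta> in auto)
qed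

section \<open>Empirical covariance operators\<close>

lemma norm_tensor_le: "norm (y \<otimes>\<^sub>S z) \<le> norm y * norm z"
proof (rule hs_norm_le)
  fix F assume F: "finite F" "F \<subseteq> (hs_basis :: 'a set)"
  have "(\<Sum>e\<in>F. (norm (hs_apply (y \<otimes>\<^sub>S z) e))\<^sup>2) = (\<Sum>e\<in>F. (inner y e)\<^sup>2) * (norm z)\<^sup>2"
    by (simp add: power_mult_distrib sum_distrib_right)
  also have "\<dots> \<le> (norm y * norm z)\<^sup>2"
    using bessel[OF hs_basis(3) F, of y] by (simp add: mult_right_mono power_mult_distrib)
  finally show "(\<Sum>e\<in>F. (norm (hs_apply (y \<otimes>\<^sub>S z) e))\<^sup>2) \<le> (norm y * norm z)\<^sup>2" .
qed simp

lemma bounded_bilinear_tensor: "bounded_bilinear (\<otimes>\<^sub>S)"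
proof
  show "\<exists>K. \<forall>a b :: 'a. norm (a \<otimes>\<^sub>S b) \<le> norm a * norm b * K"
    by (intro exI[of _ 1]) (simp add: norm_tensor_le)
qed (simp_all flip: hs_apply_inject add: fun_eq_iff inner_add_left algebra_simps)

lemma measurable_tensor_self [measurable]: "(\<lambda>x. x \<otimes>\<^sub>S x) \<in> borel_measurable borel"
  by (intro borel_measurable_continuous_onI
      bounded_bilinear.continuous_on[OF bounded_bilinear_tensor] continuous_on_id)

lemma (in prob_space) indep_vars_imp_indep_var:
  assumes "indep_vars M' X I" "i \<in> I" "j \<in> I" "i \<noteq> j"
  shows "indep_var (M' i) (X i) (M' j) (X j)"
proof -
  have "indep_var (M' i) ((\<lambda>f. f i) \<circ> (\<lambda>\<omega>. restrict (\<lambda>i. X i \<omega>) {i}))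
      (M' j) ((\<lambda>f. f j) \<circ> (\<lambda>\<omega>. restrict (\<lambda>i. X i \<omega>) {j}))"
    using assms by (intro indep_var_compose[OF indep_var_restrict[OF assms(1)]]) auto
  thus ?thesis by (simp add: comp_def)
qed

theorem corollary3p1:
  fixes T :: "'e::euclidean_space set"
    and cls :: "('e \<Rightarrow> real) \<Rightarrow> 'h::{real_inner, banach, second_countable_topology}"
    and M :: "'a measure"
    and X :: "'a \<Rightarrow> 'h"
    and Xs :: "nat \<Rightarrow> 'a \<Rightarrow> 'h"
    and \<alpha> \<gamma> :: real
    and C :: "'h hs"
    and v :: "nat \<Rightarrow> 'h"
    and \<xi> :: "nat \<Rightarrow> 'a \<Rightarrow> real"
    and Q :: "nat \<Rightarrow> nat \<Rightarrow> real"
  assumes T: "compact T"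
    and L2: "is_L2 T cls"
    and M: "prob_space M"
    and indep: "prob_space.indep_vars M (\<lambda>_. borel) (\<lambda>n. if n = 0 then X else Xs n) UNIV"
    and ident: "\<And>n. n \<ge> 1 \<Longrightarrow> distr M borel (Xs n) = distr M borel X"
    and mean_zero: "has_bochner_integral M X 0"
    and rv: "regularly_varying M X \<alpha>"
    and \<alpha>: "2 < \<alpha>" "\<alpha> < 4"
    and C: "C = covariance_operator M X"
    and v: "ordered_eigenfunctions C v"
    and \<xi>: "\<And>j \<omega>. \<xi> j \<omega> = inner (X \<omega>) (v j)"
    and Q: "\<And>n m. n \<ge> 1 \<Longrightarrow> m \<ge> 1 \<Longrightarrow>
      ((\<lambda>u. measure M {\<omega> \<in> space M. sqrt (\<Sum>j. (\<xi> (n + j) \<omega>)\<^sup>2) * sqrt (\<Sum>j. (\<xi> (m + j) \<omega>)\<^sup>2) > u}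
          / measure M {\<omega> \<in> space M. (\<Sum>j. (\<xi> (1 + j) \<omega>)\<^sup>2) > u}) \<longlongrightarrow> Q n m) at_top"
    and Q_pos: "\<And>n m. n \<ge> 1 \<Longrightarrow> m \<ge> 1 \<Longrightarrow> Q n m > 0"
    and \<gamma>: "1 \<le> \<gamma>" "\<gamma> < \<alpha> / 2"
  shows "AE \<omega> in M. (\<lambda>N. real N powr (1 - 1 / \<gamma>) * norm (empirical_covariance Xs N \<omega> - C)) \<longlonglongrightarrow> 0"
proof -
  interpret prob_space M by (rule M)
  define W where "W = (\<lambda>\<omega>. X \<omega> \<otimes>\<^sub>S X \<omega>)"
  define Y where "Y i = (\<lambda>\<omega>. Xs (Suc i) \<omega> \<otimes>\<^sub>S Xs (Suc i) \<omega>)" for i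
  define Xa where "Xa n = (if n = 0 then X else Xs n)" for n
  have Xa: "indep_vars (\<lambda>_. borel) Xa UNIV" using indep unfolding Xa_def .
  hence meas: "random_variable borel (Xa n)" for n by (simp add: indep_vars_def)
  have X[measurable]: "random_variable borel X" using meas[of 0] by (simp add: Xa_def)
  have Xs[measurable]: "random_variable borel (Xs (Suc i))" for i
    using meas[of "Suc i"] by (simp add: Xa_def)
  \<comment> \<open>The moment of order \<open>p\<close> of \<open>X \<otimes> X\<close> is one of order \<open>2 p\<close> of \<open>X\<close>, which is why \<open>p < \<alpha> / 2\<close> is
    required besides \<open>\<gamma> < p \<le> 2\<close>.\<close>
  define p where "p = min 2 ((\<gamma> + \<alpha> / 2) / 2)"
  have p: "\<gamma> < p" "p \<le> 2" "p < \<alpha> / 2" using \<gamma> \<alpha> by (auto simp: p_def min_def)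
  have "AE \<omega> in M. (\<lambda>N. real N powr (- 1 / \<gamma>) * norm (\<Sum>i<N. Y i \<omega> - expectation W)) \<longlonglongrightarrow> 0"
  proof (rule marcinkiewicz_zygmund_strong_law[OF _ _ _ _ \<gamma>(1) p(1,2)])
    show Wm: "random_variable borel W" "random_variable borel (Y i)" for i
      unfolding W_def Y_def by measurable
    show "distr M borel (Y i) = distr M borel W" for i
    proof -
      have "distr (distr M borel (Xs (Suc i))) borel (\<lambda>x. x \<otimes>\<^sub>S x)
          = distr (distr M borel X) borel (\<lambda>x. x \<otimes>\<^sub>S x)"
        by (simp add: ident)
      thus ?thesis by (simp add: distr_distr comp_def Y_def W_def)
    qed
    show "indep_var borel (Y i) borel (Y j)" if "i \<noteq> j" for i j
    proof -
      have "indep_var borel (Xa (Suc i)) borel (Xa (Suc j))"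
        using indep_vars_imp_indep_var[OF Xa, of "Suc i" "Suc j"] that by simp
      from indep_var_compose[OF this measurable_tensor_self measurable_tensor_self]
      show ?thesis by (simp add: Y_def Xa_def comp_def)
    qed
    show "integrable M (\<lambda>\<omega>. norm (W \<omega>) powr p)"
    proof (rule Bochner_Integration.integrable_bound)
      show "integrable M (\<lambda>\<omega>. norm (X \<omega>) powr (2 * p))"
        using p \<gamma> by (intro regularly_varying_integrable_powr[OF rv]) auto
      have "norm (W \<omega>) powr p \<le> norm (X \<omega>) powr (2 * p)" for \<omega>
      proof -
        have "norm (W \<omega>) powr p \<le> (norm (X \<omega>) * norm (X \<omega>)) powr p"
          unfolding W_def using p \<gamma> by (intro powr_mono2 norm_tensor_le) auto
        also have "\<dots> = norm (X \<omega>) powr (2 * p)" by (simp add: powr_mult flip: powr_add)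
        finally show ?thesis .
      qed
      thus "AE \<omega> in M. norm (norm (W \<omega>) powr p) \<le> norm (norm (X \<omega>) powr (2 * p))" by simp
    qed (use Wm in measurable)
  qed
  moreover have "real N powr (- 1 / \<gamma>) * norm (\<Sum>i<N. Y i \<omega> - expectation W)
      = real N powr (1 - 1 / \<gamma>) * norm (empirical_covariance Xs N \<omega> - C)" for N \<omega>
  proof (cases "N = 0")
    case False
    have "(\<Sum>n=1..N. Xs n \<omega> \<otimes>\<^sub>S Xs n \<omega>) = (\<Sum>i<N. Y i \<omega>)"
      unfolding Y_def by (rule sum.reindex_bij_witness[of _ Suc "\<lambda>n. n - 1"]) auto
    hence "(\<Sum>i<N. Y i \<omega> - expectation W) = real N *\<^sub>R (empirical_covariance Xs N \<omega> - C)"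
      using False
      by (simp add: empirical_covariance_def C covariance_operator_def W_def sum_subtractf
          sum_constant_scaleR scaleR_diff_right)
    hence "norm (\<Sum>i<N. Y i \<omega> - expectation W) = real N * norm (empirical_covariance Xs N \<omega> - C)"
      by simp
    moreover have "real N powr (1 - 1 / \<gamma>) = real N powr (- 1 / \<gamma>) * real N"
      using False by (simp add: powr_diff powr_minus_divide)
    ultimately show ?thesis by simp
  qed simp
  ultimately show ?thesis by simp
qed
end
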